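(* Let $R$ be a ring with unity, let $\mathcal{X}$ be a semibrick of left $R$-modules and let $M\in\mathrm{Filt}(\mathcal{X})$. The following statements are equivalent: (i) $M$ is $\mathcal{X}$-semisimple; (ii) $\mathrm{tr}_{\mathcal{X}}\,M=M$.
   Context: A brick is a finitely presented left $R$-module whose endomorphism ring is a division ring. A semibrick is a class $\mathcal{X}$ of pairwise non-isomorphic bricks with $\mathrm{Hom}(X,X')=0$ for distinct $X,X'\in\mathcal{X}$. A filtration of a module $M$ is an ascending chain $(M_\lambda,\lambda\le\mu)$ of submodules ($\mu$ an ordinal) with $M_0=0$, $M_\mu=M$ and $M_\nu=\bigcup_{\lambda<\nu}M_\lambda$ for limit ordinals $\nu\le\mu$. It is an $\mathcal{X}$-filtration if each $M_{\lambda+1}/M_\lambda$ ($\lambda<\mu$) is isomorphic to a module in $\mathcal{X}$. $\mathrm{Filt}(\mathcal{X})$ is the class of modules admitting an $\mathcal{X}$-filtration. The $\mathcal{X}$-trace of $M$ is $\mathrm{tr}_{\mathcal{X}}M=\sum_{X\in\mathcal{X},\,f\in\mathrm{Hom}(X,M)}\mathrm{Im}\,f$. A module $M\in\mathrm{Filt}(\mathcal{X})$ is $\mathcal{X}$-semisimple if it is isomorphic to a direct sum of objects from $\mathcal{X}$ (repetitions allowed). *)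

theory Defs
  imports "HOL-Algebra.Module" "HOL-Algebra.AbelCoset"
begin

section \<open>Left modules over an arbitrary ring\<close>

text \<open>
  The locale \<^locale>\<open>module\<close> requires a commutative ring of scalars, so it is restated here with
  \<^locale>\<open>ring\<close> in place of \<^locale>\<open>cring\<close>.  The \<open>mult\<close> and \<open>one\<close> fields of a module record are junk.
\<close>

locale left_module = R?: ring R + M?: abelian_group M for R (structure) and M (structure) +
  assumes smult_closed:
      "\<lbrakk>a \<in> carrier R; x \<in> carrier M\<rbrakk> \<Longrightarrow> a \<odot>\<^bsub>M\<^esub> x \<in> carrier M"
    and smult_l_distr:
      "\<lbrakk>a \<in> carrier R; b \<in> carrier R; x \<in> carrier M\<rbrakk> \<Longrightarrow>
        (a \<oplus>\<^bsub>R\<^esub> b) \<odot>\<^bsub>M\<^esub> x = a \<odot>\<^bsub>M\<^esub> x \<oplus>\<^bsub>M\<^esub> b \<odot>\<^bsub>M\<^esub> x"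
    and smult_r_distr:
      "\<lbrakk>a \<in> carrier R; x \<in> carrier M; y \<in> carrier M\<rbrakk> \<Longrightarrow>
        a \<odot>\<^bsub>M\<^esub> (x \<oplus>\<^bsub>M\<^esub> y) = a \<odot>\<^bsub>M\<^esub> x \<oplus>\<^bsub>M\<^esub> a \<odot>\<^bsub>M\<^esub> y"
    and smult_assoc:
      "\<lbrakk>a \<in> carrier R; b \<in> carrier R; x \<in> carrier M\<rbrakk> \<Longrightarrow>
        (a \<otimes>\<^bsub>R\<^esub> b) \<odot>\<^bsub>M\<^esub> x = a \<odot>\<^bsub>M\<^esub> (b \<odot>\<^bsub>M\<^esub> x)"
    and smult_one:
      "x \<in> carrier M \<Longrightarrow> \<one>\<^bsub>R\<^esub> \<odot>\<^bsub>M\<^esub> x = x"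

lemma module_iff_left_module: "module R M \<longleftrightarrow> cring R \<and> left_module R M"
  by (auto simp: module_def module_axioms_def left_module_def left_module_axioms_def cring_def)

text \<open>Homomorphisms are extensional, so that \<open>Hom\<close> sets and endomorphism rings have
  the usual notion of equality.\<close>

definition mod_hom :: "('r, 'k) ring_scheme \<Rightarrow> ('r, 'a, 'l) module_scheme \<Rightarrow>
    ('r, 'b, 'n) module_scheme \<Rightarrow> ('a \<Rightarrow> 'b) set" where
  "mod_hom R M N = {f \<in> carrier M \<rightarrow>\<^sub>E carrier N.
     (\<forall>x\<in>carrier M. \<forall>y\<in>carrier M. f (x \<oplus>\<^bsub>M\<^esub> y) = f x \<oplus>\<^bsub>N\<^esub> f y) \<and>
     (\<forall>a\<in>carrier R. \<forall>x\<in>carrier M. f (a \<odot>\<^bsub>M\<^esub> x) = a \<odot>\<^bsub>N\<^esub> f x)}"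

definition mod_iso :: "('r, 'k) ring_scheme \<Rightarrow> ('r, 'a, 'l) module_scheme \<Rightarrow>
    ('r, 'b, 'n) module_scheme \<Rightarrow> bool" where
  "mod_iso R M N \<longleftrightarrow> (\<exists>f \<in> mod_hom R M N. bij_betw f (carrier M) (carrier N))"

definition quotient_module :: "('r, 'a, 'l) module_scheme \<Rightarrow> 'a set \<Rightarrow> ('r, 'a set) module" where
  "quotient_module M N =
     \<lparr>carrier = a_rcosets\<^bsub>M\<^esub> N, mult = undefined, one = undefined,
      zero = N, add = set_add M, smult = (\<lambda>a C. \<Union>x\<in>C. N +>\<^bsub>M\<^esub> (a \<odot>\<^bsub>M\<^esub> x))\<rparr>"

definition direct_sum :: "'i set \<Rightarrow> ('i \<Rightarrow> ('r, 'a, 'l) module_scheme) \<Rightarrow> ('r, 'i \<Rightarrow> 'a) module" where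
  "direct_sum I S =
     \<lparr>carrier = {x \<in> \<Pi>\<^sub>E i\<in>I. carrier (S i). finite {i \<in> I. x i \<noteq> \<zero>\<^bsub>S i\<^esub>}},
      mult = undefined, one = undefined,
      zero = (\<lambda>i\<in>I. \<zero>\<^bsub>S i\<^esub>), add = (\<lambda>x y. \<lambda>i\<in>I. x i \<oplus>\<^bsub>S i\<^esub> y i),
      smult = (\<lambda>a x. \<lambda>i\<in>I. a \<odot>\<^bsub>S i\<^esub> x i)\<rparr>"

text \<open>The sum of a family of submodules, as the set of all finite sums.\<close>

definition submodule_sum :: "('r, 'a, 'l) module_scheme \<Rightarrow> 'i set \<Rightarrow> ('i \<Rightarrow> 'a set) \<Rightarrow> 'a set" where
  "submodule_sum M I N = {finsum M x J | J x. finite J \<and> J \<subseteq> I \<and> x \<in> (\<Pi> i\<in>J. N i)}"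


section \<open>Bricks and semibricks\<close>

definition regular_module :: "('r, 'k) ring_scheme \<Rightarrow> ('r, 'r) module" where
  "regular_module R =
     \<lparr>carrier = carrier R, mult = undefined, one = undefined,
      zero = \<zero>\<^bsub>R\<^esub>, add = add R, smult = mult R\<rparr>"

abbreviation free_module :: "('r, 'k) ring_scheme \<Rightarrow> nat \<Rightarrow> ('r, nat \<Rightarrow> 'r) module" where
  "free_module R n \<equiv> direct_sum {..<n} (\<lambda>_. regular_module R)"

text \<open>There is an exact sequence \<open>R\<^sup>m \<rightarrow> R\<^sup>n \<rightarrow> M \<rightarrow> 0\<close>.\<close>

definition finitely_presented :: "('r, 'k) ring_scheme \<Rightarrow> ('r, 'a, 'l) module_scheme \<Rightarrow> bool" where
  "finitely_presented R M \<longleftrightarrow>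
     (\<exists>m n. \<exists>g \<in> mod_hom R (free_module R m) (free_module R n).
        \<exists>f \<in> mod_hom R (free_module R n) M.
          g ` carrier (free_module R m) = {x \<in> carrier (free_module R n). f x = \<zero>\<^bsub>M\<^esub>} \<and>
          f ` carrier (free_module R n) = carrier M)"

definition End_ring :: "('r, 'k) ring_scheme \<Rightarrow> ('r, 'a, 'l) module_scheme \<Rightarrow> ('a \<Rightarrow> 'a) ring" where
  "End_ring R M =
     \<lparr>carrier = mod_hom R M M, mult = compose (carrier M), one = (\<lambda>x\<in>carrier M. x),
      zero = (\<lambda>x\<in>carrier M. \<zero>\<^bsub>M\<^esub>), add = (\<lambda>f g. \<lambda>x\<in>carrier M. f x \<oplus>\<^bsub>M\<^esub> g x)\<rparr>"

definition division_ring :: "('d, 'k) ring_scheme \<Rightarrow> bool" where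
  "division_ring D \<longleftrightarrow> ring D \<and> \<one>\<^bsub>D\<^esub> \<noteq> \<zero>\<^bsub>D\<^esub> \<and> Units D = carrier D - {\<zero>\<^bsub>D\<^esub>}"

definition brick :: "('r, 'k) ring_scheme \<Rightarrow> ('r, 'a, 'l) module_scheme \<Rightarrow> bool" where
  "brick R X \<longleftrightarrow> left_module R X \<and> finitely_presented R X \<and> division_ring (End_ring R X)"

text \<open>
  A class of pairwise non-isomorphic finitely presented modules is necessarily a set, and every
  finitely presented module is isomorphic to one on a fixed type (such as \<open>(nat \<Rightarrow> 'r) set\<close>);
  the carrier type \<open>'a\<close> is left arbitrary.
\<close>

definition semibrick :: "('r, 'k) ring_scheme \<Rightarrow> ('r, 'a) module set \<Rightarrow> bool" where
  "semibrick R \<X> \<longleftrightarrow>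
     (\<forall>X\<in>\<X>. brick R X) \<and>
     (\<forall>X\<in>\<X>. \<forall>Y\<in>\<X>. X \<noteq> Y \<longrightarrow>
        \<not> mod_iso R X Y \<and> mod_hom R X Y = {\<lambda>x\<in>carrier X. \<zero>\<^bsub>Y\<^esub>})"


section \<open>Filtrations\<close>

text \<open>
  The ordinals \<open>\<lambda> \<le> \<mu>\<close> indexing a filtration are represented by the elements of \<open>Field r\<close> for
  a well-order \<open>r\<close> with a greatest element.
\<close>

definition successor_in :: "'i rel \<Rightarrow> 'i \<Rightarrow> 'i \<Rightarrow> bool" where
  "successor_in r a b \<longleftrightarrow> a \<in> Field r \<and> b \<in> Field r \<and> underS r b = under r a"

definition limit_in :: "'i rel \<Rightarrow> 'i \<Rightarrow> bool" where
  "limit_in r b \<longleftrightarrow> b \<in> Field r \<and> underS r b \<noteq> {} \<and> (\<nexists>a. successor_in r a b)"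

definition filtration :: "('r, 'k) ring_scheme \<Rightarrow> ('r, 'a, 'l) module_scheme \<Rightarrow>
    'i rel \<Rightarrow> ('i \<Rightarrow> 'a set) \<Rightarrow> bool" where
  "filtration R M r F \<longleftrightarrow>
     Well_order r \<and>
     (\<forall>a\<in>Field r. submodule (F a) R M) \<and>
     (\<forall>a b. (a, b) \<in> r \<longrightarrow> F a \<subseteq> F b) \<and>
     (\<forall>a\<in>Field r. underS r a = {} \<longrightarrow> F a = {\<zero>\<^bsub>M\<^esub>}) \<and>
     (\<exists>t\<in>Field r. under r t = Field r \<and> F t = carrier M) \<and>
     (\<forall>b. limit_in r b \<longrightarrow> F b = (\<Union>a\<in>underS r b. F a))"

definition X_filtration :: "('r, 'k) ring_scheme \<Rightarrow> ('r, 'x) module set \<Rightarrow>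
    ('r, 'a, 'l) module_scheme \<Rightarrow> 'i rel \<Rightarrow> ('i \<Rightarrow> 'a set) \<Rightarrow> bool" where
  "X_filtration R \<X> M r F \<longleftrightarrow>
     filtration R M r F \<and>
     (\<forall>a b. successor_in r a b \<longrightarrow>
        (\<exists>X\<in>\<X>. mod_iso R (quotient_module (M\<lparr>carrier := F b\<rparr>) (F a)) X))"

text \<open>
  A type cannot be quantified existentially, so the index set of the filtration is taken inside
  the carrier type of the module.  This loses no generality when the members of \<open>\<X>\<close> are nonzero
  (as bricks are): such a filtration is strictly increasing; see \<open>FiltI\<close> below.
\<close>

definition Filt :: "('r, 'k) ring_scheme \<Rightarrow> ('r, 'x) module set \<Rightarrow> ('r, 'm) module set" where
  "Filt R \<X> = {M. left_module R M \<and> (\<exists>(r :: 'm rel) F. X_filtration R \<X> M r F)}"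


section \<open>Trace and semisimplicity\<close>

definition trace :: "('r, 'k) ring_scheme \<Rightarrow> ('r, 'x) module set \<Rightarrow>
    ('r, 'm, 'l) module_scheme \<Rightarrow> 'm set" where
  "trace R \<X> M = submodule_sum M (SIGMA X:\<X>. mod_hom R X M) (\<lambda>(X, f). f ` carrier X)"

text \<open>
  Again the index set of the direct sum may be taken inside the carrier type of the module,
  because the summands are nonzero; see \<open>X_semisimpleI\<close> below.
\<close>

definition X_semisimple :: "('r, 'k) ring_scheme \<Rightarrow> ('r, 'x) module set \<Rightarrow>
    ('r, 'm) module \<Rightarrow> bool" where
  "X_semisimple R \<X> M \<longleftrightarrow>
     (\<exists>(I :: 'm set) S. S \<in> I \<rightarrow> \<X> \<and> mod_iso R M (direct_sum I S))"


section \<open>Independence of the index types\<close>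

lemma brick_nonzero:
  assumes "brick R X"
  obtains x where "x \<in> carrier X" "x \<noteq> \<zero>\<^bsub>X\<^esub>"
proof (rule ccontr)
  assume "\<not> thesis"
  with that have "\<And>x. x \<in> carrier X \<Longrightarrow> x = \<zero>\<^bsub>X\<^esub>" by blast
  hence "\<one>\<^bsub>End_ring R X\<^esub> = \<zero>\<^bsub>End_ring R X\<^esub>"
    by (auto simp: End_ring_def restrict_def fun_eq_iff)
  with assms show False by (simp add: brick_def division_ring_def)
qed

lemma X_semisimpleI:
  fixes I :: "'i set" and \<X> :: "('r, 'x) module set" and M :: "('r, 'm) module"
  assumes sb: "semibrick R \<X>" and M: "left_module R M" and S: "S \<in> I \<rightarrow> \<X>" and iso: "mod_iso R M (direct_sum I S)"
  shows "X_semisimple R \<X> M"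
proof -
  obtain f where f: "f \<in> mod_hom R M (direct_sum I S)"
    and bij: "bij_betw f (carrier M) (carrier (direct_sum I S))"
    using iso by (auto simp: mod_iso_def)
  have br: "brick R (S i)" if "i \<in> I" for i
    using sb S that by (auto simp: semibrick_def)
  have "\<exists>x. x \<in> carrier (S i) \<and> x \<noteq> \<zero>\<^bsub>S i\<^esub>" if "i \<in> I" for i
    using brick_nonzero[OF br[OF that]] by blast
  then obtain s where s: "\<And>i. i \<in> I \<Longrightarrow> s i \<in> carrier (S i) \<and> s i \<noteq> \<zero>\<^bsub>S i\<^esub>"
    by metis
  have zero: "\<zero>\<^bsub>S i\<^esub> \<in> carrier (S i)" if "i \<in> I" for i
  proof -
    have "abelian_group (S i)" using br[OF that] by (simp add: brick_def left_module_def)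
    then interpret abelian_group "S i" .
    show ?thesis by simp
  qed
  define d where "d i = (\<lambda>j\<in>I. if j = i then s i else \<zero>\<^bsub>S j\<^esub>)" for i
  have dc: "d i \<in> carrier (direct_sum I S)" if "i \<in> I" for i
  proof -
    have "{j \<in> I. d i j \<noteq> \<zero>\<^bsub>S j\<^esub>} \<subseteq> {i}" by (auto simp: d_def)
    hence "finite {j \<in> I. d i j \<noteq> \<zero>\<^bsub>S j\<^esub>}" by (rule finite_subset) simp
    thus ?thesis using s zero that by (auto simp: direct_sum_def d_def)
  qed
  define g where "g i = inv_into (carrier M) f (d i)" for i
  have fg: "f (g i) = d i" if "i \<in> I" for i
    using dc[OF that] bij unfolding g_def by (simp add: bij_betw_inv_into_right)
  have inj: "inj_on g I"
  proof (rule inj_onI)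
    fix i j assume ij: "i \<in> I" "j \<in> I" "g i = g j"
    hence "d i i = d j i" using fg by metis
    thus "i = j" using ij s by (auto simp: d_def split: if_splits)
  qed
  define h where "h = inv_into I g"
  have hg: "h (g i) = i" if "i \<in> I" for i using inj that by (simp add: h_def)
  define J where "J = g ` I"
  define T where "T = S \<circ> h"
  define p where "p x = (\<lambda>j\<in>J. x (h j))" for x :: "'i \<Rightarrow> 'x"
  define q where "q y = (\<lambda>i\<in>I. y (g i))" for y :: "'m \<Rightarrow> 'x"
  have hJ: "h j \<in> I" "g (h j) = j" if "j \<in> J" for j using that hg by (auto simp: J_def)
  have gI: "g i \<in> J" if "i \<in> I" for i using that by (auto simp: J_def)
  have pc: "p x \<in> carrier (direct_sum J T)" if "x \<in> carrier (direct_sum I S)" for x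
  proof -
    have "{j \<in> J. p x j \<noteq> \<zero>\<^bsub>T j\<^esub>} \<subseteq> g ` {i \<in> I. x i \<noteq> \<zero>\<^bsub>S i\<^esub>}"
      using hJ by (auto simp: p_def T_def intro!: rev_image_eqI)
    moreover have "finite (g ` {i \<in> I. x i \<noteq> \<zero>\<^bsub>S i\<^esub>})"
      using that by (simp add: direct_sum_def)
    ultimately have "finite {j \<in> J. p x j \<noteq> \<zero>\<^bsub>T j\<^esub>}" by (rule finite_subset)
    thus ?thesis using that hJ by (auto simp: direct_sum_def p_def T_def)
  qed
  have qc: "q y \<in> carrier (direct_sum I S)" if "y \<in> carrier (direct_sum J T)" for y
  proof -
    have "{i \<in> I. q y i \<noteq> \<zero>\<^bsub>S i\<^esub>} \<subseteq> h ` {j \<in> J. y j \<noteq> \<zero>\<^bsub>T j\<^esub>}"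
      using hg gI by (auto simp: q_def T_def intro!: rev_image_eqI)
    moreover have "finite (h ` {j \<in> J. y j \<noteq> \<zero>\<^bsub>T j\<^esub>})"
      using that by (simp add: direct_sum_def)
    ultimately have "finite {i \<in> I. q y i \<noteq> \<zero>\<^bsub>S i\<^esub>}" by (rule finite_subset)
    moreover have "y (g i) \<in> carrier (S i)" if "i \<in> I" for i
      using \<open>y \<in> carrier (direct_sum J T)\<close> gI[OF that] hg[OF that]
      by (auto simp: direct_sum_def T_def PiE_iff)
    ultimately show ?thesis by (auto simp: direct_sum_def q_def)
  qed
  have qp: "q (p x) = x" if "x \<in> carrier (direct_sum I S)" for x
    using that hg gI by (auto simp: q_def p_def direct_sum_def fun_eq_iff PiE_def extensional_def)
  have pq: "p (q y) = y" if "y \<in> carrier (direct_sum J T)" for y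
    using that hJ by (auto simp: q_def p_def direct_sum_def fun_eq_iff PiE_def extensional_def)
  have bp: "bij_betw p (carrier (direct_sum I S)) (carrier (direct_sum J T))"
    by (rule bij_betw_byWitness[where f' = q]) (use pc qc qp pq in auto)
  define k where "k = compose (carrier M) p f"
  have fc: "f x \<in> carrier (direct_sum I S)" if "x \<in> carrier M" for x
    using f that by (auto simp: mod_hom_def)
  have "bij_betw k (carrier M) (carrier (direct_sum J T))"
    using bij_betw_trans[OF bij bp]
    by (rule bij_betw_cong[THEN iffD1, rotated]) (simp add: k_def compose_def)
  moreover have "k \<in> mod_hom R M (direct_sum J T)"
  proof -
    have cl: "f (x \<oplus>\<^bsub>M\<^esub> y) = f x \<oplus>\<^bsub>direct_sum I S\<^esub> f y"
      if "x \<in> carrier M" "y \<in> carrier M" for x y using f that by (auto simp: mod_hom_def)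
    have cs: "f (a \<odot>\<^bsub>M\<^esub> x) = a \<odot>\<^bsub>direct_sum I S\<^esub> f x"
      if "a \<in> carrier R" "x \<in> carrier M" for a x using f that by (auto simp: mod_hom_def)
    have pa: "p (u \<oplus>\<^bsub>direct_sum I S\<^esub> v) = p u \<oplus>\<^bsub>direct_sum J T\<^esub> p v" for u v
      using hJ by (auto simp: p_def direct_sum_def T_def fun_eq_iff)
    have ps: "p (a \<odot>\<^bsub>direct_sum I S\<^esub> u) = a \<odot>\<^bsub>direct_sum J T\<^esub> p u" for a u
      using hJ by (auto simp: p_def direct_sum_def T_def fun_eq_iff)
    interpret left_module R M by (rule M)
    have "k (x \<oplus>\<^bsub>M\<^esub> y) = k x \<oplus>\<^bsub>direct_sum J T\<^esub> k y"
      if "x \<in> carrier M" "y \<in> carrier M" for x y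
      using that M.a_closed[OF that] by (simp add: k_def compose_eq cl pa)
    moreover have "k (a \<odot>\<^bsub>M\<^esub> x) = a \<odot>\<^bsub>direct_sum J T\<^esub> k x"
      if "a \<in> carrier R" "x \<in> carrier M" for a x
      using that smult_closed[OF that] by (simp add: k_def compose_eq cs ps)
    moreover have "k \<in> carrier M \<rightarrow>\<^sub>E carrier (direct_sum J T)"
      using fc pc by (auto simp: k_def compose_def)
    ultimately show ?thesis by (simp add: mod_hom_def)
  qed
  moreover have "T \<in> J \<rightarrow> \<X>" using S hJ by (auto simp: T_def)
  ultimately show ?thesis by (auto simp: X_semisimple_def mod_iso_def)
qed

lemma X_filtration_step:
  assumes sb: "semibrick R \<X>" and M: "left_module R M" and XF: "X_filtration R \<X> M r F"
    and suc: "successor_in r a b"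
  obtains x where "x \<in> F b" "x \<notin> F a"
proof (rule ccontr)
  assume "\<not> thesis"
  with that have sub: "F b \<subseteq> F a" by blast
  interpret left_module R M by (rule M)
  have F: "filtration R M r F" using XF by (simp add: X_filtration_def)
  have "a \<in> Field r" "a \<in> under r a"
    using suc F by (auto simp: successor_in_def filtration_def under_def order_on_defs refl_on_def)
  hence "(a, b) \<in> r" using suc by (auto simp: successor_in_def underS_def)
  hence "F a \<subseteq> F b" using F unfolding filtration_def by blast
  with sub have eq: "F b = F a" by blast
  have sg: "subgroup (F a) (add_monoid M)"
    using F \<open>a \<in> Field r\<close> by (auto simp: filtration_def submodule_def)
  have coset: "F a +>\<^bsub>M\<lparr>carrier := F a\<rparr>\<^esub> x = F a" if "x \<in> F a" for x
  proof -
    have "x \<in> carrier (add_monoid M)" using subgroup.subset[OF sg] that by auto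
    from M.add.coset_join2[OF _ sg that] this have "F a #>\<^bsub>add_monoid M\<^esub> x = F a" by simp
    thus ?thesis by (simp add: a_r_coset_def r_coset_def)
  qed
  have car: "carrier (add_monoid (M\<lparr>carrier := F a\<rparr>)) = F a" by simp
  have one: "C = F a" if "C \<in> carrier (quotient_module (M\<lparr>carrier := F b\<rparr>) (F a))" for C
  proof -
    have "C \<in> a_rcosets\<^bsub>M\<lparr>carrier := F a\<rparr>\<^esub> (F a)"
      using that by (simp add: quotient_module_def eq)
    then obtain x where "x \<in> F a" "C = F a +>\<^bsub>M\<lparr>carrier := F a\<rparr>\<^esub> x"
      unfolding A_RCOSETS_def RCOSETS_def car a_r_coset_def by (elim UN_E singletonE)
    thus ?thesis using coset by simp
  qed
  obtain X f where X: "X \<in> \<X>"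
    and f: "bij_betw f (carrier (quotient_module (M\<lparr>carrier := F b\<rparr>) (F a))) (carrier X)"
    using XF suc unfolding X_filtration_def mod_iso_def by blast
  have br: "brick R X" using sb X by (simp add: semibrick_def)
  then obtain x where x: "x \<in> carrier X" "x \<noteq> \<zero>\<^bsub>X\<^esub>" by (rule brick_nonzero)
  have "abelian_group X" using br by (simp add: brick_def left_module_def)
  then interpret X: abelian_group X .
  have const: "y = f (F a)" if "y \<in> carrier X" for y
  proof -
    have "y \<in> f ` carrier (quotient_module (M\<lparr>carrier := F b\<rparr>) (F a))"
      using f that unfolding bij_betw_def by blast
    thus ?thesis using one by (elim imageE) (drule one, simp only:)
  qed
  have "x = \<zero>\<^bsub>X\<^esub>" by (rule trans[OF const[OF x(1)] const[symmetric]]) simp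
  with x(2) show False by (rule notE)
qed

lemma successor_exists:
  assumes r: "Well_order r" and a: "a \<in> Field r" and t: "(a, t) \<in> r" "a \<noteq> t"
  obtains b where "successor_in r a b" "\<And>c. (a, c) \<in> r \<Longrightarrow> a \<noteq> c \<Longrightarrow> (b, c) \<in> r"
proof -
  have wf: "wf (r - Id)" and tr: "trans r" and an: "antisym r" and tot: "total_on (Field r) r"
    and rf: "refl_on (Field r) r"
    using r by (auto simp: order_on_defs)
  define Q where "Q = {c. (a, c) \<in> r \<and> a \<noteq> c}"
  have "t \<in> Q" using t by (simp add: Q_def)
  then obtain b where b: "b \<in> Q" and min: "\<And>c. (c, b) \<in> r - Id \<Longrightarrow> c \<notin> Q"
    using wf by (auto simp: wf_eq_minimal)
  have QF: "c \<in> Field r" if "c \<in> Q" for c using that by (auto simp: Q_def Field_def)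
  have least: "(b, c) \<in> r" if "c \<in> Q" for c
  proof (cases "c = b")
    case True thus ?thesis using rf QF[OF b] by (auto simp: refl_on_def)
  next
    case False thus ?thesis using tot QF[OF b] QF[OF that] min[of c] that
      by (auto simp: total_on_def)
  qed
  have "underS r b = under r a"
  proof (intro equalityI subsetI)
    fix c assume "c \<in> underS r b"
    hence c: "(c, b) \<in> r" "c \<noteq> b" by (auto simp: underS_def)
    hence "c \<notin> Q" using min by auto
    moreover have "c \<in> Field r" using c by (auto simp: Field_def)
    ultimately show "c \<in> under r a"
      using tot rf a by (cases "a = c") (auto simp: Q_def total_on_def under_def refl_on_def)
  next
    fix c assume "c \<in> under r a"
    hence c: "(c, a) \<in> r" by (simp add: under_def)
    have ab: "(a, b) \<in> r" "a \<noteq> b" using b by (auto simp: Q_def)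
    have "(c, b) \<in> r" using tr c ab by (meson transD)
    moreover have "c \<noteq> b" using an c ab by (auto simp: antisym_def)
    ultimately show "c \<in> underS r b" by (simp add: underS_def)
  qed
  hence "successor_in r a b" using a QF[OF b] by (simp add: successor_in_def)
  thus ?thesis using that least by (auto simp: Q_def)
qed

lemma FiltI:
  fixes r :: "'i rel" and M :: "('r, 'm) module"
  assumes sb: "semibrick R \<X>" and M: "left_module R M" and XF: "X_filtration R \<X> M r F"
  shows "M \<in> Filt R \<X>"
proof -
  have F: "filtration R M r F" using XF by (simp add: X_filtration_def)
  hence r: "Well_order r" and mono: "\<And>a b. (a, b) \<in> r \<Longrightarrow> F a \<subseteq> F b"
    and sm: "\<And>a. a \<in> Field r \<Longrightarrow> submodule (F a) R M" by (auto simp: filtration_def)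
  obtain t where t: "t \<in> Field r" "under r t = Field r" "F t = carrier M"
    using F by (auto simp: filtration_def)
  have tot: "total_on (Field r) r" and an: "antisym r" using r by (auto simp: order_on_defs)
  have top: "(a, t) \<in> r" if "a \<in> Field r" for a using t that by (auto simp: under_def)
  have "\<exists>x. x \<notin> F a \<and> (\<forall>c. (a, c) \<in> r \<longrightarrow> a \<noteq> c \<longrightarrow> x \<in> F c)"
    if a: "a \<in> Field r" "a \<noteq> t" for a
  proof -
    obtain b where b: "successor_in r a b" "\<And>c. (a, c) \<in> r \<Longrightarrow> a \<noteq> c \<Longrightarrow> (b, c) \<in> r"
      using successor_exists[OF r a(1) top[OF a(1)] a(2)] by blast
    obtain x where "x \<in> F b" "x \<notin> F a" using X_filtration_step[OF sb M XF b(1)] by blast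
    thus ?thesis using b(2) mono by blast
  qed
  then obtain g0 where g0: "\<And>a. a \<in> Field r \<Longrightarrow> a \<noteq> t \<Longrightarrow> g0 a \<notin> F a"
    "\<And>a c. a \<in> Field r \<Longrightarrow> a \<noteq> t \<Longrightarrow> (a, c) \<in> r \<Longrightarrow> a \<noteq> c \<Longrightarrow> g0 a \<in> F c" by metis
  define g where "g a = (if a = t then \<zero>\<^bsub>M\<^esub> else g0 a)" for a
  have z: "\<zero>\<^bsub>M\<^esub> \<in> F a" if "a \<in> Field r" for a
    using subgroup.one_closed[OF submodule.axioms(1)[OF sm[OF that]]] by simp
  have ne: "g a \<noteq> g b" if "(a, b) \<in> r" "a \<noteq> b" for a b
  proof -
    have ab: "a \<in> Field r" "b \<in> Field r" using that by (auto simp: Field_def)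
    have "a \<noteq> t" using that top[OF ab(2)] an by (auto simp: antisym_def)
    hence "g a \<notin> F a" "g a \<in> F b" using g0 ab that by (auto simp: g_def)
    moreover have "b \<noteq> t \<Longrightarrow> g b \<notin> F b" using g0 ab by (simp add: g_def)
    moreover have "b = t \<Longrightarrow> g b \<in> F a" using z[OF ab(1)] by (simp add: g_def)
    ultimately show ?thesis by metis
  qed
  have inj: "inj_on g (Field r)"
    using ne tot unfolding inj_on_def total_on_def by metis
  define h where "h = inv_into (Field r) g"
  have hg: "h (g a) = a" if "a \<in> Field r" for a using inj that by (simp add: h_def)
  define r' where "r' = dir_image r g"
  have wr': "Well_order r'" unfolding r'_def by (rule Well_order_dir_image[OF r inj])
  have Fr': "Field r' = g ` Field r" unfolding r'_def by (rule dir_image_Field)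
  have rel: "(g a, g b) \<in> r' \<longleftrightarrow> (a, b) \<in> r" if "a \<in> Field r" "b \<in> Field r" for a b
  proof
    assume "(g a, g b) \<in> r'"
    then obtain a' b' where "g a = g a'" "g b = g b'" "(a', b') \<in> r"
      by (auto simp: r'_def dir_image_def)
    moreover have "a' \<in> Field r" "b' \<in> Field r" using calculation by (auto simp: Field_def)
    ultimately show "(a, b) \<in> r" using inj that by (metis inj_onD)
  qed (auto simp: r'_def dir_image_def)
  have r'E: "\<exists>a b. x = g a \<and> y = g b \<and> a \<in> Field r \<and> b \<in> Field r \<and> (a, b) \<in> r"
    if "(x, y) \<in> r'" for x y using that by (auto simp: r'_def dir_image_def Field_def)
  have uF: "under r a \<subseteq> Field r" "underS r a \<subseteq> Field r" for a
    by (auto simp: under_def underS_def Field_def)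
  have un: "under r' (g a) = g ` under r a" if "a \<in> Field r" for a
  proof (intro equalityI subsetI)
    fix x assume "x \<in> under r' (g a)"
    hence x: "(x, g a) \<in> r'" by (simp add: under_def)
    then obtain b where "x = g b" "b \<in> Field r" using r'E by blast
    thus "x \<in> g ` under r a" using x rel that by (auto simp: under_def)
  next
    fix x assume "x \<in> g ` under r a"
    then obtain b where "x = g b" "(b, a) \<in> r" by (auto simp: under_def)
    thus "x \<in> under r' (g a)" using rel[of b a] that by (auto simp: under_def Field_def)
  qed
  have unS: "underS r' (g a) = g ` underS r a" if "a \<in> Field r" for a
  proof -
    have "underS r' (g a) = under r' (g a) - {g a}" by (auto simp: under_def underS_def)
    also have "\<dots> = g ` (under r a - {a})"
      using inj_on_image_set_diff[OF inj, of "under r a" "{a}"] un[OF that] that uF(1)[of a]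
      by auto
    also have "under r a - {a} = underS r a" by (auto simp: under_def underS_def)
    finally show ?thesis .
  qed
  have sc: "successor_in r' (g a) (g b) \<longleftrightarrow> successor_in r a b"
    if "a \<in> Field r" "b \<in> Field r" for a b
    using that un unS uF inj Fr'
    by (auto simp: successor_in_def inj_on_image_eq_iff[OF inj])
  have lm: "limit_in r' (g b) \<longleftrightarrow> limit_in r b" if "b \<in> Field r" for b
  proof -
    have "(\<exists>a. successor_in r' a (g b)) \<longleftrightarrow> (\<exists>a. successor_in r a b)"
    proof
      assume "\<exists>a. successor_in r' a (g b)"
      then obtain a where a: "successor_in r' a (g b)" ..
      then obtain c where "a = g c" "c \<in> Field r" using Fr' by (auto simp: successor_in_def)
      thus "\<exists>a. successor_in r a b" using a sc that by auto
    next
      assume "\<exists>a. successor_in r a b"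
      then obtain a where a: "successor_in r a b" ..
      hence "a \<in> Field r" by (simp add: successor_in_def)
      thus "\<exists>a. successor_in r' a (g b)" using a sc that by auto
    qed
    thus ?thesis using that Fr' unS by (auto simp: limit_in_def)
  qed
  define F' where "F' = F \<circ> h"
  have F': "F' (g a) = F a" if "a \<in> Field r" for a using hg that by (simp add: F'_def)
  have "filtration R M r' F'"
    unfolding filtration_def
  proof (intro conjI allI ballI impI)
    show "Well_order r'" by (rule wr')
    show "submodule (F' a) R M" if "a \<in> Field r'" for a using that Fr' F' sm by auto
    show "F' a \<subseteq> F' b" if "(a, b) \<in> r'" for a b using r'E[OF that] F' mono by metis
    show "F' a = {\<zero>\<^bsub>M\<^esub>}" if "a \<in> Field r'" "underS r' a = {}" for a
      using that Fr' F' unS F by (auto simp: filtration_def)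
    show "\<exists>t\<in>Field r'. under r' t = Field r' \<and> F' t = carrier M"
      using t un[OF t(1)] Fr' F' by auto
    fix b assume b: "limit_in r' b"
    then obtain c where c: "b = g c" "c \<in> Field r" using Fr' by (auto simp: limit_in_def)
    hence "F c = (\<Union>a\<in>underS r c. F a)" using b lm F by (auto simp: filtration_def)
    moreover have "(\<Union>a\<in>underS r' b. F' a) = (\<Union>a\<in>underS r c. F a)"
      using c unS uF(2)[of c] F' by (auto simp: subset_eq)
    ultimately show "F' b = (\<Union>a\<in>underS r' b. F' a)" using c F' by simp
  qed
  moreover have "\<exists>X\<in>\<X>. mod_iso R (quotient_module (M\<lparr>carrier := F' b\<rparr>) (F' a)) X"
    if s: "successor_in r' a b" for a b
  proof -
    obtain c d where "a = g c" "b = g d" "c \<in> Field r" "d \<in> Field r"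
      using s Fr' by (auto simp: successor_in_def)
    thus ?thesis using s sc F' XF by (auto simp: X_filtration_def)
  qed
  ultimately have "X_filtration R \<X> M r' F'" by (simp add: X_filtration_def)
  thus ?thesis using M by (auto simp: Filt_def)
qed

end

theory Submission
  imports Defs
begin

text \<open>
  Suppose \<open>M\<close> equals its trace, and let \<open>F\<close> be a filtration of \<open>M\<close>.  If a homomorphism \<open>f : X \<rightarrow> M\<close>
  with \<open>X \<in> \<X>\<close> has image in \<open>F (a + 1)\<close> but not in \<open>F a\<close>, then its composite with the projection
  to the factor \<open>F (a + 1) / F a \<cong> X'\<close> is a nonzero map of the semibrick, hence an isomorphism, and
  \<open>F (a + 1) = F a \<oplus> Im f\<close>.  Choose one such \<open>f\<close> for every step \<open>a\<close> that admits one.  The images are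
  independent: in a finite relation the summand of the highest step would lie in \<open>F a\<close>.
  They span the trace, by well-founded induction on the level containing the image of an arbitrary
  \<open>g : X \<rightarrow> M\<close>: at a limit finite generation of \<open>X\<close> lowers the level, and at a successor one
  subtracts from \<open>g\<close> the chosen \<open>f\<close> composed with a suitable isomorphism to land in \<open>F a\<close>.
\<close>

section \<open>Homomorphisms and submodules\<close>

lemma mod_hom_closed: "f \<in> mod_hom R M N \<Longrightarrow> x \<in> carrier M \<Longrightarrow> f x \<in> carrier N"
  by (auto simp: mod_hom_def)

lemma mod_hom_add:
  "f \<in> mod_hom R M N \<Longrightarrow> x \<in> carrier M \<Longrightarrow> y \<in> carrier M \<Longrightarrow> f (x \<oplus>\<^bsub>M\<^esub> y) = f x \<oplus>\<^bsub>N\<^esub> f y"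
  by (simp add: mod_hom_def)

lemma mod_hom_smult:
  "f \<in> mod_hom R M N \<Longrightarrow> a \<in> carrier R \<Longrightarrow> x \<in> carrier M \<Longrightarrow> f (a \<odot>\<^bsub>M\<^esub> x) = a \<odot>\<^bsub>N\<^esub> f x"
  by (simp add: mod_hom_def)

lemma mod_homI:
  assumes "f \<in> extensional (carrier M)" "\<And>x. x \<in> carrier M \<Longrightarrow> f x \<in> carrier N"
    and "\<And>x y. x \<in> carrier M \<Longrightarrow> y \<in> carrier M \<Longrightarrow> f (x \<oplus>\<^bsub>M\<^esub> y) = f x \<oplus>\<^bsub>N\<^esub> f y"
    and "\<And>a x. a \<in> carrier R \<Longrightarrow> x \<in> carrier M \<Longrightarrow> f (a \<odot>\<^bsub>M\<^esub> x) = a \<odot>\<^bsub>N\<^esub> f x"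
  shows "f \<in> mod_hom R M N"
  using assms by (simp add: mod_hom_def PiE_def)

lemma mod_hom_zero:
  assumes "abelian_group M" "abelian_group N" "f \<in> mod_hom R M N"
  shows "f \<zero>\<^bsub>M\<^esub> = \<zero>\<^bsub>N\<^esub>"
proof -
  interpret M: abelian_group M by fact
  interpret N: abelian_group N by fact
  have "f \<zero>\<^bsub>M\<^esub> \<oplus>\<^bsub>N\<^esub> f \<zero>\<^bsub>M\<^esub> = f \<zero>\<^bsub>M\<^esub>"
    using mod_hom_add[OF assms(3), of "\<zero>\<^bsub>M\<^esub>" "\<zero>\<^bsub>M\<^esub>"] by simp
  thus ?thesis
    using mod_hom_closed[OF assms(3), of "\<zero>\<^bsub>M\<^esub>"] N.add.l_cancel_one' by force
qed

lemma mod_hom_compose: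
  assumes "left_module R L" "f \<in> mod_hom R L M" "g \<in> mod_hom R M N"
  shows "compose (carrier L) g f \<in> mod_hom R L N"
proof -
  interpret L: left_module R L by fact
  show ?thesis
    by (rule mod_homI)
      (simp_all add: compose_eq compose_extensional mod_hom_closed[OF assms(2)]
        mod_hom_closed[OF assms(3)] mod_hom_add[OF assms(2)] mod_hom_add[OF assms(3)]
        mod_hom_smult[OF assms(2)] mod_hom_smult[OF assms(3)] L.smult_closed)
qed

lemma mod_iso_sym:
  assumes M: "left_module R M" and "mod_iso R M N"
  shows "mod_iso R N M"
proof -
  obtain f where f: "f \<in> mod_hom R M N" and bij: "bij_betw f (carrier M) (carrier N)"
    using assms(2) by (auto simp: mod_iso_def)
  interpret M: left_module R M by fact
  define g where "g = restrict (inv_into (carrier M) f) (carrier N)"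
  have gf: "g (f x) = x" if "x \<in> carrier M" for x
    using bij that mod_hom_closed[OF f that] by (simp add: g_def bij_betw_inv_into_left)
  have E: "\<exists>x\<in>carrier M. y = f x" if "y \<in> carrier N" for y
    using bij that by (auto simp: bij_betw_def)
  have gc: "g y \<in> carrier M" if "y \<in> carrier N" for y using E[OF that] gf by auto
  have "g \<in> mod_hom R N M"
  proof (rule mod_homI)
    fix x y assume "x \<in> carrier N" "y \<in> carrier N"
    then obtain u v where "u \<in> carrier M" "v \<in> carrier M" "x = f u" "y = f v" using E by meson
    thus "g (x \<oplus>\<^bsub>N\<^esub> y) = g x \<oplus>\<^bsub>M\<^esub> g y"
      using gf gf[of "u \<oplus>\<^bsub>M\<^esub> v"] by (simp add: mod_hom_add[OF f])
  next
    fix a x assume a: "a \<in> carrier R" and "x \<in> carrier N"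
    then obtain u where "u \<in> carrier M" "x = f u" using E by meson
    thus "g (a \<odot>\<^bsub>N\<^esub> x) = a \<odot>\<^bsub>M\<^esub> g x"
      using gf gf[of "a \<odot>\<^bsub>M\<^esub> u"] a by (simp add: mod_hom_smult[OF f] M.smult_closed)
  qed (use gc in \<open>auto simp: g_def\<close>)
  moreover have "bij_betw g (carrier N) (carrier M)"
    using bij_betw_inv_into[OF bij] by (simp add: g_def cong: bij_betw_cong)
  ultimately show ?thesis by (auto simp: mod_iso_def)
qed

context left_module
begin

lemma smult_zero_right: "a \<in> carrier R \<Longrightarrow> a \<odot>\<^bsub>M\<^esub> \<zero>\<^bsub>M\<^esub> = \<zero>\<^bsub>M\<^esub>"
  using smult_r_distr[of a "\<zero>\<^bsub>M\<^esub>" "\<zero>\<^bsub>M\<^esub>"] smult_closed[of a "\<zero>\<^bsub>M\<^esub>"] M.add.l_cancel_one'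
  by force

lemma smult_zero_left: "x \<in> carrier M \<Longrightarrow> \<zero>\<^bsub>R\<^esub> \<odot>\<^bsub>M\<^esub> x = \<zero>\<^bsub>M\<^esub>"
  using smult_l_distr[of "\<zero>\<^bsub>R\<^esub>" "\<zero>\<^bsub>R\<^esub>" x] smult_closed[of "\<zero>\<^bsub>R\<^esub>" x] M.add.l_cancel_one'
  by force

lemma smult_minus_right:
  assumes "a \<in> carrier R" "x \<in> carrier M"
  shows "a \<odot>\<^bsub>M\<^esub> (\<ominus>\<^bsub>M\<^esub> x) = \<ominus>\<^bsub>M\<^esub> (a \<odot>\<^bsub>M\<^esub> x)"
proof -
  have "a \<odot>\<^bsub>M\<^esub> (\<ominus>\<^bsub>M\<^esub> x) \<oplus>\<^bsub>M\<^esub> a \<odot>\<^bsub>M\<^esub> x = \<zero>\<^bsub>M\<^esub>"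
    using smult_r_distr[of a "\<ominus>\<^bsub>M\<^esub> x" x] assms smult_zero_right by (simp add: M.l_neg)
  thus ?thesis using assms smult_closed M.minus_equality by force
qed

lemma smult_minus_one:
  assumes "x \<in> carrier M"
  shows "(\<ominus>\<^bsub>R\<^esub> \<one>\<^bsub>R\<^esub>) \<odot>\<^bsub>M\<^esub> x = \<ominus>\<^bsub>M\<^esub> x"
proof -
  have "(\<ominus>\<^bsub>R\<^esub> \<one>\<^bsub>R\<^esub>) \<odot>\<^bsub>M\<^esub> x \<oplus>\<^bsub>M\<^esub> x = \<zero>\<^bsub>M\<^esub>"
    using smult_l_distr[of "\<ominus>\<^bsub>R\<^esub> \<one>\<^bsub>R\<^esub>" "\<one>\<^bsub>R\<^esub>" x] assms smult_zero_left
    by (simp add: R.l_neg smult_one)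
  thus ?thesis using assms smult_closed M.minus_equality by force
qed

lemma submoduleI:
  assumes sub: "H \<subseteq> carrier M" and z: "\<zero>\<^bsub>M\<^esub> \<in> H"
    and add: "\<And>x y. x \<in> H \<Longrightarrow> y \<in> H \<Longrightarrow> x \<oplus>\<^bsub>M\<^esub> y \<in> H"
    and smult: "\<And>a x. a \<in> carrier R \<Longrightarrow> x \<in> H \<Longrightarrow> a \<odot>\<^bsub>M\<^esub> x \<in> H"
  shows "submodule H R M"
proof -
  have "\<ominus>\<^bsub>M\<^esub> x \<in> H" if "x \<in> H" for x
    using smult[of "\<ominus>\<^bsub>R\<^esub> \<one>\<^bsub>R\<^esub>" x] smult_minus_one[of x] that sub by auto
  hence "subgroup H (add_monoid M)"
    by (intro M.add.subgroupI) (use sub z add in \<open>auto simp: a_inv_def\<close>)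
  thus ?thesis using smult by (simp add: submodule_def submodule_axioms_def)
qed

lemma submodule_subset: "submodule H R M \<Longrightarrow> H \<subseteq> carrier M"
  using subgroup.subset[of H "add_monoid M"] by (simp add: submodule_def)

lemma submodule_zero: "submodule H R M \<Longrightarrow> \<zero>\<^bsub>M\<^esub> \<in> H"
  using subgroup.one_closed[of H "add_monoid M"] by (simp add: submodule_def)

lemma submodule_add: "submodule H R M \<Longrightarrow> x \<in> H \<Longrightarrow> y \<in> H \<Longrightarrow> x \<oplus>\<^bsub>M\<^esub> y \<in> H"
  using subgroup.m_closed[of H "add_monoid M" x y] by (simp add: submodule_def)

lemma submodule_minus: "submodule H R M \<Longrightarrow> x \<in> H \<Longrightarrow> \<ominus>\<^bsub>M\<^esub> x \<in> H"
  using subgroup.m_inv_closed[of H "add_monoid M" x] by (simp add: submodule_def a_inv_def)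

lemma submodule_smult: "submodule H R M \<Longrightarrow> a \<in> carrier R \<Longrightarrow> x \<in> H \<Longrightarrow> a \<odot>\<^bsub>M\<^esub> x \<in> H"
  by (auto simp: submodule_def submodule_axioms_def)

lemma submodule_finsum:
  assumes H: "submodule H R M" and "finite J" "\<And>j. j \<in> J \<Longrightarrow> x j \<in> H"
  shows "finsum M x J \<in> H"
  using assms(2,3)
proof (induction J)
  case empty
  show ?case using submodule_zero[OF H] by simp
next
  case (insert j J)
  hence "x \<in> J \<rightarrow> carrier M" "x j \<in> carrier M" using submodule_subset[OF H] by auto
  thus ?case using insert submodule_add[OF H] by simp
qed

lemma submodule_image:
  assumes "left_module R L" and f: "f \<in> mod_hom R L M"
  shows "submodule (f ` carrier L) R M"
proof -
  interpret L: left_module R L by fact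
  have z: "f \<zero>\<^bsub>L\<^esub> = \<zero>\<^bsub>M\<^esub>"
    using mod_hom_zero[OF _ _ f] L.M.abelian_group_axioms M.abelian_group_axioms by blast
  show ?thesis
  proof (rule submoduleI)
    fix x y assume "x \<in> f ` carrier L" "y \<in> f ` carrier L"
    thus "x \<oplus>\<^bsub>M\<^esub> y \<in> f ` carrier L"
      by (elim imageE) (auto simp: mod_hom_add[OF f, symmetric])
  next
    fix a x assume "a \<in> carrier R" "x \<in> f ` carrier L"
    thus "a \<odot>\<^bsub>M\<^esub> x \<in> f ` carrier L"
      by (elim imageE) (auto simp: mod_hom_smult[OF f, symmetric] L.smult_closed)
  next
    show "\<zero>\<^bsub>M\<^esub> \<in> f ` carrier L" using z L.M.zero_closed by (metis imageI)
  qed (use mod_hom_closed[OF f] in auto)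
qed

lemma mod_hom_diff:
  assumes "left_module R L" and f: "f \<in> mod_hom R L M" and g: "g \<in> mod_hom R L M"
  shows "(\<lambda>x\<in>carrier L. f x \<ominus>\<^bsub>M\<^esub> g x) \<in> mod_hom R L M"
proof -
  interpret L: left_module R L by fact
  note [simp] = mod_hom_closed[OF f] mod_hom_closed[OF g]
  show ?thesis
  proof (rule mod_homI)
    fix x y assume "x \<in> carrier L" "y \<in> carrier L"
    thus "(\<lambda>x\<in>carrier L. f x \<ominus>\<^bsub>M\<^esub> g x) (x \<oplus>\<^bsub>L\<^esub> y) =
      (\<lambda>x\<in>carrier L. f x \<ominus>\<^bsub>M\<^esub> g x) x \<oplus>\<^bsub>M\<^esub> (\<lambda>x\<in>carrier L. f x \<ominus>\<^bsub>M\<^esub> g x) y"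
      by (simp add: mod_hom_add[OF f] mod_hom_add[OF g] a_minus_def M.minus_add M.a_ac)
  next
    fix a x assume "a \<in> carrier R" "x \<in> carrier L"
    thus "(\<lambda>x\<in>carrier L. f x \<ominus>\<^bsub>M\<^esub> g x) (a \<odot>\<^bsub>L\<^esub> x) = a \<odot>\<^bsub>M\<^esub> (\<lambda>x\<in>carrier L. f x \<ominus>\<^bsub>M\<^esub> g x) x"
      by (simp add: mod_hom_smult[OF f] mod_hom_smult[OF g] a_minus_def L.smult_closed
          smult_r_distr smult_minus_right)
  qed auto
qed

lemma smult_finsum:
  assumes "a \<in> carrier R" "finite J" "x \<in> J \<rightarrow> carrier M"
  shows "a \<odot>\<^bsub>M\<^esub> finsum M x J = finsum M (\<lambda>i. a \<odot>\<^bsub>M\<^esub> x i) J"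
  using assms(2,3)
  by induction (simp_all add: assms(1) smult_zero_right smult_r_distr smult_closed Pi_iff)

lemma submodule_vimage:
  assumes "left_module R L" and f: "f \<in> mod_hom R L M" and H: "submodule H R M"
  shows "submodule {x \<in> carrier L. f x \<in> H} R L"
proof -
  interpret L: left_module R L by fact
  have "f \<zero>\<^bsub>L\<^esub> = \<zero>\<^bsub>M\<^esub>"
    using mod_hom_zero[OF _ _ f] L.M.abelian_group_axioms M.abelian_group_axioms by blast
  thus ?thesis
    by (intro L.submoduleI)
      (auto simp: mod_hom_add[OF f] mod_hom_smult[OF f] L.smult_closed
        submodule_zero[OF H] submodule_add[OF H] submodule_smult[OF H])
qed

lemma submodule_submodule_sum:
  assumes N: "\<And>i. i \<in> I \<Longrightarrow> submodule (N i) R M"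
  shows "submodule (submodule_sum M I N) R M"
proof (rule submoduleI)
  show "submodule_sum M I N \<subseteq> carrier M"
    using submodule_subset[OF N] by (auto simp: submodule_sum_def subset_eq intro!: M.finsum_closed)
  show "\<zero>\<^bsub>M\<^esub> \<in> submodule_sum M I N"
    unfolding submodule_sum_def by (rule CollectI, rule exI[of _ "{}"]) simp
next
  fix u v assume "u \<in> submodule_sum M I N" "v \<in> submodule_sum M I N"
  then obtain J x K y where J: "finite J" "J \<subseteq> I" "x \<in> (\<Pi> i\<in>J. N i)" "u = finsum M x J"
    and K: "finite K" "K \<subseteq> I" "y \<in> (\<Pi> i\<in>K. N i)" "v = finsum M y K"
    by (auto simp: submodule_sum_def)
  have Nc: "x \<in> carrier M" if "i \<in> I" "x \<in> N i" for i x
    using submodule_subset[OF N[OF that(1)]] that(2) by blast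
  define x' where "x' i = (if i \<in> J then x i else \<zero>\<^bsub>M\<^esub>)" for i
  define y' where "y' i = (if i \<in> K then y i else \<zero>\<^bsub>M\<^esub>)" for i
  have x'N: "x' i \<in> N i" if "i \<in> J \<union> K" for i
    using J K that submodule_zero[OF N] by (auto simp: x'_def Pi_iff subset_eq)
  have y'N: "y' i \<in> N i" if "i \<in> J \<union> K" for i
    using J K that submodule_zero[OF N] by (auto simp: y'_def Pi_iff subset_eq)
  have x': "x' \<in> J \<union> K \<rightarrow> carrier M" and y': "y' \<in> J \<union> K \<rightarrow> carrier M"
    using x'N y'N Nc J(2) K(2) by blast+
  have "u = finsum M x' (J \<union> K)" unfolding J(4)
    by (rule M.add.finprod_mono_neutral_cong_left) (use J K x' in \<open>auto simp: x'_def\<close>)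
  moreover have "v = finsum M y' (J \<union> K)" unfolding K(4)
    by (rule M.add.finprod_mono_neutral_cong_left) (use J K y' in \<open>auto simp: y'_def\<close>)
  ultimately have "u \<oplus>\<^bsub>M\<^esub> v = finsum M (\<lambda>i. x' i \<oplus>\<^bsub>M\<^esub> y' i) (J \<union> K)"
    using x' y' by (simp add: M.finsum_addf)
  moreover have "(\<lambda>i. x' i \<oplus>\<^bsub>M\<^esub> y' i) \<in> (\<Pi> i\<in>J \<union> K. N i)"
    using x'N y'N submodule_add[OF N] J(2) K(2) by blast
  ultimately show "u \<oplus>\<^bsub>M\<^esub> v \<in> submodule_sum M I N"
    unfolding submodule_sum_def using J K by blast
next
  fix a u assume a: "a \<in> carrier R" and "u \<in> submodule_sum M I N"
  then obtain J x where J: "finite J" "J \<subseteq> I" "x \<in> (\<Pi> i\<in>J. N i)" "u = finsum M x J"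
    by (auto simp: submodule_sum_def)
  have xc: "x \<in> J \<rightarrow> carrier M" using J submodule_subset[OF N] by (auto simp: Pi_iff subset_eq)
  have "a \<odot>\<^bsub>M\<^esub> finsum M x J = finsum M (\<lambda>i. a \<odot>\<^bsub>M\<^esub> x i) J"
    using smult_finsum[OF a J(1) xc] .
  moreover have "(\<lambda>i. a \<odot>\<^bsub>M\<^esub> x i) \<in> (\<Pi> i\<in>J. N i)"
    using J submodule_smult[OF N] a by (auto simp: Pi_iff subset_eq)
  ultimately show "a \<odot>\<^bsub>M\<^esub> u \<in> submodule_sum M I N"
    unfolding submodule_sum_def using J by blast
qed

lemma submodule_sum_member:
  assumes "i \<in> I" "x \<in> N i" "x \<in> carrier M"
  shows "x \<in> submodule_sum M I N"
  unfolding submodule_sum_def using assms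
  by (intro CollectI exI[of _ "{i}"] exI[of _ "\<lambda>_. x"]) (auto simp: M.finsum_insert)

end


section \<open>Direct sums\<close>

lemma left_module_regular:
  assumes "ring R"
  shows "left_module R (regular_module R)"
proof -
  interpret ring R by fact
  have "abelian_group (regular_module R)"
    by (rule abelian_groupI) (auto simp: regular_module_def a_ac intro: l_neg bexI[OF _ a_inv_closed])
  thus ?thesis
    using assms unfolding left_module_def left_module_axioms_def
    by (simp add: regular_module_def l_distr r_distr m_assoc)
qed

lemma left_module_direct_sum:
  assumes "ring R" and S: "\<And>i. i \<in> I \<Longrightarrow> left_module R (S i)"
  shows "left_module R (direct_sum I S)"
proof -
  let ?D = "direct_sum I S"
  have ab: "abelian_group (S i)" if "i \<in> I" for i using S[OF that] by (simp add: left_module_def)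
  note am = abelian_group.axioms(1)[OF ab]
  note [simp] = abelian_monoid.a_closed[OF am] abelian_monoid.zero_closed[OF am]
    abelian_monoid.l_zero[OF am] left_module.smult_closed[OF S] left_module.smult_zero_right[OF S]
    abelian_group.a_inv_closed[OF ab] abelian_group.l_neg[OF ab]
  have [simp]: "\<ominus>\<^bsub>S i\<^esub> \<zero>\<^bsub>S i\<^esub> = \<zero>\<^bsub>S i\<^esub>" if "i \<in> I" for i
    using abelian_group.minus_equality[OF ab[OF that], of "\<zero>\<^bsub>S i\<^esub>" "\<zero>\<^bsub>S i\<^esub>"] that by simp
  have fin: "finite {i \<in> I. h (x i) (y i) i \<noteq> \<zero>\<^bsub>S i\<^esub>}"
    if "x \<in> carrier ?D" "y \<in> carrier ?D" "\<And>i. i \<in> I \<Longrightarrow> h \<zero>\<^bsub>S i\<^esub> \<zero>\<^bsub>S i\<^esub> i = \<zero>\<^bsub>S i\<^esub>" for x y h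
  proof (rule finite_subset)
    show "{i \<in> I. h (x i) (y i) i \<noteq> \<zero>\<^bsub>S i\<^esub>} \<subseteq>
        {i \<in> I. x i \<noteq> \<zero>\<^bsub>S i\<^esub>} \<union> {i \<in> I. y i \<noteq> \<zero>\<^bsub>S i\<^esub>}"
      using that(3) by force
    show "finite ({i \<in> I. x i \<noteq> \<zero>\<^bsub>S i\<^esub>} \<union> {i \<in> I. y i \<noteq> \<zero>\<^bsub>S i\<^esub>})"
      using that(1,2) by (simp add: direct_sum_def)
  qed
  have c: "x i \<in> carrier (S i)" if "x \<in> carrier ?D" "i \<in> I" for x i
    using that by (auto simp: direct_sum_def)
  have ex: "x = (\<lambda>i\<in>I. x i)" if "x \<in> carrier ?D" for x
    using that by (auto simp: direct_sum_def PiE_def extensional_restrict)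
  have addc: "x \<oplus>\<^bsub>?D\<^esub> y \<in> carrier ?D" if "x \<in> carrier ?D" "y \<in> carrier ?D" for x y
    using that fin[OF that, of "\<lambda>u v i. u \<oplus>\<^bsub>S i\<^esub> v"] c[OF that(1)] c[OF that(2)]
    by (auto simp: direct_sum_def cong: conj_cong)
  have smc: "a \<odot>\<^bsub>?D\<^esub> x \<in> carrier ?D" if "a \<in> carrier R" "x \<in> carrier ?D" for a x
    using that fin[OF that(2,2), of "\<lambda>u v i. a \<odot>\<^bsub>S i\<^esub> u"] c[OF that(2)]
    by (auto simp: direct_sum_def cong: conj_cong)
  have zc: "\<zero>\<^bsub>?D\<^esub> \<in> carrier ?D" by (auto simp: direct_sum_def)
  have "abelian_group ?D"
  proof (rule abelian_groupI)
    fix x y z assume "x \<in> carrier ?D" "y \<in> carrier ?D" "z \<in> carrier ?D"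
    thus "x \<oplus>\<^bsub>?D\<^esub> y \<oplus>\<^bsub>?D\<^esub> z = x \<oplus>\<^bsub>?D\<^esub> (y \<oplus>\<^bsub>?D\<^esub> z)"
      using c[of x] c[of y] c[of z]
      by (simp add: direct_sum_def fun_eq_iff abelian_monoid.a_assoc[OF am])
  next
    fix x y assume "x \<in> carrier ?D" "y \<in> carrier ?D"
    thus "x \<oplus>\<^bsub>?D\<^esub> y = y \<oplus>\<^bsub>?D\<^esub> x"
      using c[of x] c[of y] by (simp add: direct_sum_def fun_eq_iff abelian_monoid.a_comm[OF am])
  next
    fix x assume x: "x \<in> carrier ?D"
    show "\<zero>\<^bsub>?D\<^esub> \<oplus>\<^bsub>?D\<^esub> x = x"
      using c[OF x] by (subst (2) ex[OF x]) (simp add: direct_sum_def fun_eq_iff)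
    let ?y = "\<lambda>i\<in>I. \<ominus>\<^bsub>S i\<^esub> x i"
    have "?y \<in> carrier ?D"
      using x fin[OF x x, of "\<lambda>u v i. \<ominus>\<^bsub>S i\<^esub> u"] c[OF x]
      by (auto simp: direct_sum_def cong: conj_cong)
    moreover have "?y \<oplus>\<^bsub>?D\<^esub> x = \<zero>\<^bsub>?D\<^esub>"
      using c[OF x] by (simp add: direct_sum_def fun_eq_iff)
    ultimately show "\<exists>y\<in>carrier ?D. y \<oplus>\<^bsub>?D\<^esub> x = \<zero>\<^bsub>?D\<^esub>" by blast
  qed (use addc zc in auto)
  moreover have "(a \<oplus>\<^bsub>R\<^esub> b) \<odot>\<^bsub>?D\<^esub> x = a \<odot>\<^bsub>?D\<^esub> x \<oplus>\<^bsub>?D\<^esub> b \<odot>\<^bsub>?D\<^esub> x"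
    "(a \<otimes>\<^bsub>R\<^esub> b) \<odot>\<^bsub>?D\<^esub> x = a \<odot>\<^bsub>?D\<^esub> (b \<odot>\<^bsub>?D\<^esub> x)"
    if "a \<in> carrier R" "b \<in> carrier R" "x \<in> carrier ?D" for a b x
    using that c[OF that(3)]
    by (simp_all add: direct_sum_def fun_eq_iff left_module.smult_l_distr[OF S]
        left_module.smult_assoc[OF S])
  moreover have "a \<odot>\<^bsub>?D\<^esub> (x \<oplus>\<^bsub>?D\<^esub> y) = a \<odot>\<^bsub>?D\<^esub> x \<oplus>\<^bsub>?D\<^esub> a \<odot>\<^bsub>?D\<^esub> y"
    if "a \<in> carrier R" "x \<in> carrier ?D" "y \<in> carrier ?D" for a x y
    using that c[OF that(2)] c[OF that(3)]
    by (simp add: direct_sum_def fun_eq_iff left_module.smult_r_distr[OF S])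
  moreover have "\<one>\<^bsub>R\<^esub> \<odot>\<^bsub>?D\<^esub> x = x" if "x \<in> carrier ?D" for x
    using c[OF that] by (subst (2) ex[OF that])
      (simp add: direct_sum_def fun_eq_iff left_module.smult_one[OF S])
  ultimately show ?thesis
    using \<open>ring R\<close> smc by (simp add: left_module_def left_module_axioms_def)
qed

definition single :: "'i set \<Rightarrow> ('i \<Rightarrow> ('r, 'a, 'l) module_scheme) \<Rightarrow> 'i \<Rightarrow> 'a \<Rightarrow> 'i \<Rightarrow> 'a" where
  "single I S i s = (\<lambda>j\<in>I. if j = i then s else \<zero>\<^bsub>S j\<^esub>)"

lemma single_closed:
  assumes S: "\<And>i. i \<in> I \<Longrightarrow> left_module R (S i)" and "i \<in> I" "s \<in> carrier (S i)"
  shows "single I S i s \<in> carrier (direct_sum I S)"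
proof -
  have "{j \<in> I. single I S i s j \<noteq> \<zero>\<^bsub>S j\<^esub>} \<subseteq> {i}" by (auto simp: single_def)
  hence "finite {j \<in> I. single I S i s j \<noteq> \<zero>\<^bsub>S j\<^esub>}" by (rule finite_subset) simp
  moreover have "\<zero>\<^bsub>S j\<^esub> \<in> carrier (S j)" if "j \<in> I" for j
    using S[OF that] by (simp add: left_module_def abelian_group_def abelian_monoid.zero_closed)
  ultimately show ?thesis using assms by (auto simp: direct_sum_def single_def)
qed

lemma single_hom:
  assumes S: "\<And>i. i \<in> I \<Longrightarrow> left_module R (S i)" and i: "i \<in> I"
  shows "restrict (single I S i) (carrier (S i)) \<in> mod_hom R (S i) (direct_sum I S)"
proof -
  interpret left_module R "S i" by (rule S[OF i])
  have ab: "abelian_group (S j)" if "j \<in> I" for j using S[OF that] by (simp add: left_module_def)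
  note am = abelian_group.axioms(1)[OF ab]
  note [simp] = abelian_monoid.zero_closed[OF am] abelian_monoid.l_zero[OF am]
    left_module.smult_zero_right[OF S]
  show ?thesis
    by (rule mod_homI) (use single_closed[OF S i] in
      \<open>auto simp: smult_closed fun_eq_iff single_def direct_sum_def\<close>)
qed

lemma direct_sum_induct [consumes 1, case_names left_module zero add single]:
  assumes x: "x \<in> carrier (direct_sum I S)" and S: "\<And>i. i \<in> I \<Longrightarrow> left_module R (S i)"
    and z: "P \<zero>\<^bsub>direct_sum I S\<^esub>"
    and add: "\<And>x y. x \<in> carrier (direct_sum I S) \<Longrightarrow> y \<in> carrier (direct_sum I S) \<Longrightarrow>
      P x \<Longrightarrow> P y \<Longrightarrow> P (x \<oplus>\<^bsub>direct_sum I S\<^esub> y)"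
    and sg: "\<And>i s. i \<in> I \<Longrightarrow> s \<in> carrier (S i) \<Longrightarrow> P (single I S i s)"
  shows "P x"
proof -
  let ?D = "direct_sum I S"
  have ab: "abelian_group (S i)" if "i \<in> I" for i using S[OF that] by (simp add: left_module_def)
  note am = abelian_group.axioms(1)[OF ab]
  note [simp] = abelian_monoid.zero_closed[OF am] abelian_monoid.l_zero[OF am]
    abelian_monoid.r_zero[OF am]
  have "P x" if "finite K" "x \<in> carrier ?D" "{i \<in> I. x i \<noteq> \<zero>\<^bsub>S i\<^esub>} \<subseteq> K" for K x
    using that
  proof (induction K arbitrary: x)
    case empty
    hence "x = \<zero>\<^bsub>?D\<^esub>" by (auto simp: direct_sum_def fun_eq_iff PiE_def extensional_def)
    thus ?case using z by simp
  next
    case (insert k K)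
    show ?case
    proof (cases "k \<in> I")
      case False
      hence "{i \<in> I. x i \<noteq> \<zero>\<^bsub>S i\<^esub>} \<subseteq> K" using insert.prems(2) by auto
      thus ?thesis using insert by blast
    next
      case True
      define y where "y = (\<lambda>i\<in>I. if i = k then \<zero>\<^bsub>S i\<^esub> else x i)"
      have sub: "{i \<in> I. y i \<noteq> \<zero>\<^bsub>S i\<^esub>} \<subseteq> K" using insert.prems by (auto simp: y_def)
      have yc: "y \<in> carrier ?D" using insert.prems finite_subset[OF sub insert.hyps(1)]
        by (auto simp: direct_sum_def y_def)
      have xk: "x k \<in> carrier (S k)" using insert.prems True by (auto simp: direct_sum_def)
      have "x i = (y \<oplus>\<^bsub>?D\<^esub> single I S k (x k)) i" for i
        using insert.prems True
        by (auto simp: direct_sum_def y_def single_def PiE_def extensional_def Pi_iff)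
      hence "x = y \<oplus>\<^bsub>?D\<^esub> single I S k (x k)" by blast
      thus ?thesis
        using add[OF yc _ insert.IH[OF yc sub] sg[OF True xk]] single_closed[of I R S, OF S True xk]
        by simp
    qed
  qed
  thus ?thesis using x by (auto simp: direct_sum_def)
qed

context left_module
begin

definition direct_sum_map :: "'i set \<Rightarrow> ('i \<Rightarrow> ('a, 'e, 'f) module_scheme) \<Rightarrow> ('i \<Rightarrow> 'e \<Rightarrow> 'c) \<Rightarrow>
    ('i \<Rightarrow> 'e) \<Rightarrow> 'c" where
  "direct_sum_map I S e =
     (\<lambda>x\<in>carrier (direct_sum I S). finsum M (\<lambda>i. e i (x i)) {i \<in> I. x i \<noteq> \<zero>\<^bsub>S i\<^esub>})"

lemma direct_sum_map_eq:
  assumes S: "\<And>i. i \<in> I \<Longrightarrow> left_module R (S i)" and e: "\<And>i. i \<in> I \<Longrightarrow> e i \<in> mod_hom R (S i) M"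
    and x: "x \<in> carrier (direct_sum I S)"
    and J: "finite J" "J \<subseteq> I" "{i \<in> I. x i \<noteq> \<zero>\<^bsub>S i\<^esub>} \<subseteq> J"
  shows "direct_sum_map I S e x = finsum M (\<lambda>i. e i (x i)) J"
proof -
  have "e i (x i) \<in> carrier M" if "i \<in> I" for i
    using x that mod_hom_closed[OF e[OF that]] by (auto simp: direct_sum_def)
  moreover have "e i \<zero>\<^bsub>S i\<^esub> = \<zero>\<^bsub>M\<^esub>" if "i \<in> I" for i
    using mod_hom_zero[OF _ M.abelian_group_axioms e[OF that]] S[OF that]
    by (simp add: left_module_def)
  ultimately have "finsum M (\<lambda>i. e i (x i)) {i \<in> I. x i \<noteq> \<zero>\<^bsub>S i\<^esub>} = finsum M (\<lambda>i. e i (x i)) J"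
    by (intro M.add.finprod_mono_neutral_cong_left) (use J in auto)
  thus ?thesis using x by (simp add: direct_sum_map_def)
qed

lemma direct_sum_map_single:
  assumes S: "\<And>i. i \<in> I \<Longrightarrow> left_module R (S i)" and e: "\<And>i. i \<in> I \<Longrightarrow> e i \<in> mod_hom R (S i) M"
    and i: "i \<in> I" "s \<in> carrier (S i)"
  shows "direct_sum_map I S e (single I S i s) = e i s"
proof -
  have "direct_sum_map I S e (single I S i s) = finsum M (\<lambda>j. e j (single I S i s j)) {i}"
    by (rule direct_sum_map_eq[OF S e single_closed[of I R S, OF S i]])
      (use i in \<open>auto simp: single_def\<close>)
  also have "\<dots> = e i s"
    using i mod_hom_closed[OF e] by (subst M.finsum_insert) (auto simp: single_def)
  finally show ?thesis .
qed

lemma direct_sum_map_hom: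
  assumes S: "\<And>i. i \<in> I \<Longrightarrow> left_module R (S i)" and e: "\<And>i. i \<in> I \<Longrightarrow> e i \<in> mod_hom R (S i) M"
  shows "direct_sum_map I S e \<in> mod_hom R (direct_sum I S) M"
proof -
  let ?D = "direct_sum I S" and ?s = "direct_sum_map I S e"
  interpret D: left_module R ?D by (rule left_module_direct_sum[OF R.ring_axioms S])
  have ec: "e i (x i) \<in> carrier M" if "x \<in> carrier ?D" "i \<in> I" for x i
    using that mod_hom_closed[OF e[OF that(2)]] by (auto simp: direct_sum_def)
  have xc: "x i \<in> carrier (S i)" if "x \<in> carrier ?D" "i \<in> I" for x i
    using that by (auto simp: direct_sum_def)
  have fin: "finite {i \<in> I. x i \<noteq> \<zero>\<^bsub>S i\<^esub>}" if "x \<in> carrier ?D" for x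
    using that by (simp add: direct_sum_def)
  note eq = direct_sum_map_eq[where e = e, OF S e]
  show ?thesis
  proof (rule mod_homI)
    fix x assume "x \<in> carrier ?D"
    thus "?s x \<in> carrier M"
      using ec by (auto simp: direct_sum_map_def intro!: M.finsum_closed)
  next
    fix x y assume x: "x \<in> carrier ?D" and y: "y \<in> carrier ?D"
    have xy: "x \<oplus>\<^bsub>?D\<^esub> y \<in> carrier ?D" using x y by simp
    define J where "J = {i \<in> I. x i \<noteq> \<zero>\<^bsub>S i\<^esub>} \<union> {i \<in> I. y i \<noteq> \<zero>\<^bsub>S i\<^esub>} \<union>
      {i \<in> I. (x \<oplus>\<^bsub>?D\<^esub> y) i \<noteq> \<zero>\<^bsub>S i\<^esub>}"
    have J: "finite J" "J \<subseteq> I" using fin x y xy by (auto simp: J_def)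
    have "?s (x \<oplus>\<^bsub>?D\<^esub> y) = finsum M (\<lambda>i. e i ((x \<oplus>\<^bsub>?D\<^esub> y) i)) J"
      by (rule eq[OF _ _ xy J]) (auto simp: J_def)
    also have "\<dots> = finsum M (\<lambda>i. e i (x i) \<oplus>\<^bsub>M\<^esub> e i (y i)) J"
    proof (rule M.finsum_cong')
      fix i assume "i \<in> J"
      hence i: "i \<in> I" using J by blast
      thus "e i ((x \<oplus>\<^bsub>?D\<^esub> y) i) = e i (x i) \<oplus>\<^bsub>M\<^esub> e i (y i)"
        using mod_hom_add[OF e[OF i] xc[OF x i] xc[OF y i]] by (simp add: direct_sum_def)
    qed (use ec x y J in auto)
    also have "\<dots> = finsum M (\<lambda>i. e i (x i)) J \<oplus>\<^bsub>M\<^esub> finsum M (\<lambda>i. e i (y i)) J"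
      by (rule M.finsum_addf) (use ec x y J in auto)
    also have "finsum M (\<lambda>i. e i (x i)) J = ?s x"
      by (rule eq[OF _ _ x J, symmetric]) (auto simp: J_def)
    also have "finsum M (\<lambda>i. e i (y i)) J = ?s y"
      by (rule eq[OF _ _ y J, symmetric]) (auto simp: J_def)
    finally show "?s (x \<oplus>\<^bsub>?D\<^esub> y) = ?s x \<oplus>\<^bsub>M\<^esub> ?s y" .
  next
    fix a x assume a: "a \<in> carrier R" and x: "x \<in> carrier ?D"
    have ax: "a \<odot>\<^bsub>?D\<^esub> x \<in> carrier ?D" using a x by (rule D.smult_closed)
    define J where "J = {i \<in> I. x i \<noteq> \<zero>\<^bsub>S i\<^esub>} \<union> {i \<in> I. (a \<odot>\<^bsub>?D\<^esub> x) i \<noteq> \<zero>\<^bsub>S i\<^esub>}"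
    have J: "finite J" "J \<subseteq> I" using fin x ax by (auto simp: J_def)
    have "?s (a \<odot>\<^bsub>?D\<^esub> x) = finsum M (\<lambda>i. e i ((a \<odot>\<^bsub>?D\<^esub> x) i)) J"
      by (rule eq[OF _ _ ax J]) (auto simp: J_def)
    also have "\<dots> = finsum M (\<lambda>i. a \<odot>\<^bsub>M\<^esub> e i (x i)) J"
    proof (rule M.finsum_cong')
      fix i assume "i \<in> J"
      hence i: "i \<in> I" using J by blast
      thus "e i ((a \<odot>\<^bsub>?D\<^esub> x) i) = a \<odot>\<^bsub>M\<^esub> e i (x i)"
        using mod_hom_smult[OF e[OF i] a xc[OF x i]] by (simp add: direct_sum_def)
    qed (use ec x J smult_closed[OF a] in auto)
    also have "\<dots> = a \<odot>\<^bsub>M\<^esub> finsum M (\<lambda>i. e i (x i)) J"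
      by (rule smult_finsum[symmetric, OF a J(1)]) (use ec x J in auto)
    also have "finsum M (\<lambda>i. e i (x i)) J = ?s x"
      by (rule eq[OF _ _ x J, symmetric]) (auto simp: J_def)
    finally show "?s (a \<odot>\<^bsub>?D\<^esub> x) = a \<odot>\<^bsub>M\<^esub> ?s x" .
  qed (simp add: direct_sum_map_def)
qed

end

lemma mod_iso_direct_sumI:
  assumes M: "left_module R M" and S: "\<And>i. i \<in> I \<Longrightarrow> left_module R (S i)"
    and f: "f \<in> mod_hom R (direct_sum I S) M" and onto: "f ` carrier (direct_sum I S) = carrier M"
    and ker: "\<And>x. x \<in> carrier (direct_sum I S) \<Longrightarrow> f x = \<zero>\<^bsub>M\<^esub> \<Longrightarrow> x = \<zero>\<^bsub>direct_sum I S\<^esub>"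
  shows "mod_iso R M (direct_sum I S)"
proof -
  interpret M: left_module R M by fact
  let ?D = "direct_sum I S"
  have D: "left_module R ?D" by (rule left_module_direct_sum[OF M.R.ring_axioms S])
  interpret D: left_module R ?D by fact
  have "inj_on f (carrier ?D)"
  proof (rule inj_onI)
    fix x y assume xy: "x \<in> carrier ?D" "y \<in> carrier ?D" "f x = f y"
    have m: "(\<ominus>\<^bsub>R\<^esub> \<one>\<^bsub>R\<^esub>) \<odot>\<^bsub>?D\<^esub> y = \<ominus>\<^bsub>?D\<^esub> y" by (rule D.smult_minus_one[OF xy(2)])
    have "f (\<ominus>\<^bsub>?D\<^esub> y) = \<ominus>\<^bsub>M\<^esub> f y"
      unfolding m[symmetric] using mod_hom_smult[OF f _ xy(2)]
      by (simp add: M.smult_minus_one mod_hom_closed[OF f xy(2)])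
    hence "f (x \<oplus>\<^bsub>?D\<^esub> \<ominus>\<^bsub>?D\<^esub> y) = \<zero>\<^bsub>M\<^esub>"
      using xy mod_hom_closed[OF f] by (simp add: mod_hom_add[OF f] M.M.r_neg)
    hence "x \<oplus>\<^bsub>?D\<^esub> \<ominus>\<^bsub>?D\<^esub> y = \<zero>\<^bsub>?D\<^esub>" using ker xy by simp
    thus "x = y" using xy by (metis D.M.minus_equality D.M.a_inv_closed D.M.minus_minus)
  qed
  hence "mod_iso R ?D M" using f onto by (auto simp: mod_iso_def bij_betw_def)
  thus ?thesis by (rule mod_iso_sym[OF D])
qed

lemma finitely_presented_generators:
  assumes "ring R" "left_module R X" "finitely_presented R X"
  obtains G where "finite G" "G \<subseteq> carrier X"
    "\<And>H. submodule H R X \<Longrightarrow> G \<subseteq> H \<Longrightarrow> H = carrier X"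
proof -
  interpret X: left_module R X by fact
  obtain n f where f: "f \<in> mod_hom R (free_module R n) X"
    and onto: "f ` carrier (free_module R n) = carrier X"
    using assms(3) unfolding finitely_presented_def by blast
  define u where "u k = single {..<n} (\<lambda>_. regular_module R) k \<one>\<^bsub>R\<^esub>" for k
  have lr: "left_module R (regular_module R)" by (rule left_module_regular) fact
  have uc: "u k \<in> carrier (free_module R n)" if "k < n" for k
    unfolding u_def by (rule single_closed[of _ R]) (use lr that in \<open>auto simp: regular_module_def\<close>)
  have "H = carrier X" if H: "submodule H R X" and u: "f ` u ` {..<n} \<subseteq> H" for H
  proof -
    have "f x \<in> H" if "x \<in> carrier (free_module R n)" for x
      using that
    proof (induction x rule: direct_sum_induct[where R = R])
      case left_module
      show ?case by (rule lr)
    next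
      case zero
      have "f \<zero>\<^bsub>free_module R n\<^esub> = \<zero>\<^bsub>X\<^esub>"
        using left_module_direct_sum[OF assms(1) lr] X.M.abelian_group_axioms
        by (intro mod_hom_zero[OF _ _ f]) (auto simp: left_module_def)
      thus ?case using X.submodule_zero[OF H] by simp
    next
      case (add x y)
      thus ?case using X.submodule_add[OF H] by (simp add: mod_hom_add[OF f])
    next
      case (single k s)
      have s: "s \<in> carrier R" using single by (simp add: regular_module_def)
      have "single {..<n} (\<lambda>_. regular_module R) k s = s \<odot>\<^bsub>free_module R n\<^esub> u k"
        using s by (auto simp: single_def u_def direct_sum_def regular_module_def fun_eq_iff)
      thus ?case
        using X.submodule_smult[OF H s] u single by (simp add: mod_hom_smult[OF f s uc] image_subset_iff)
    qed
    hence "carrier X \<subseteq> H" unfolding onto[symmetric] by (rule image_subsetI)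
    thus ?thesis using X.submodule_subset[OF H] by (rule equalityI[rotated])
  qed
  moreover have "f ` u ` {..<n} \<subseteq> carrier X" using uc mod_hom_closed[OF f] by auto
  ultimately show ?thesis by (intro that[of "f ` u ` {..<n}"]) simp_all
qed


section \<open>Filtrations by a semibrick\<close>

lemma semibrick_hom:
  assumes sb: "semibrick R \<X>" and X: "X \<in> \<X>" "Y \<in> \<X>" and g: "g \<in> mod_hom R X Y"
    and x: "x \<in> carrier X" "g x \<noteq> \<zero>\<^bsub>Y\<^esub>"
  obtains h where "X = Y" "h \<in> mod_hom R X X"
    "\<And>x. x \<in> carrier X \<Longrightarrow> h (g x) = x" "\<And>x. x \<in> carrier X \<Longrightarrow> g (h x) = x"
proof -
  have XY: "X = Y"
  proof (rule ccontr)
    assume "X \<noteq> Y"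
    hence "g = (\<lambda>x\<in>carrier X. \<zero>\<^bsub>Y\<^esub>)" using sb X g by (auto simp: semibrick_def)
    thus False using x by simp
  qed
  have "Units (End_ring R X) = carrier (End_ring R X) - {\<zero>\<^bsub>End_ring R X\<^esub>}"
    using sb X by (simp add: semibrick_def brick_def division_ring_def)
  moreover have "g \<in> carrier (End_ring R X) - {\<zero>\<^bsub>End_ring R X\<^esub>}"
    using g x XY by (auto simp: End_ring_def)
  ultimately have "g \<in> Units (End_ring R X)" by simp
  then obtain h where h: "h \<in> mod_hom R X X"
    and hg: "compose (carrier X) h g = (\<lambda>x\<in>carrier X. x)"
    and gh: "compose (carrier X) g h = (\<lambda>x\<in>carrier X. x)"
    by (auto simp: Units_def End_ring_def)
  have "h (g x) = x \<and> g (h x) = x" if "x \<in> carrier X" for x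
    using fun_cong[OF hg, of x] fun_cong[OF gh, of x] that by (simp add: compose_def)
  thus ?thesis using that XY h by blast
qed

lemma (in left_module) quotient_map:
  assumes A: "submodule A R M" and B: "submodule B R M" and AB: "A \<subseteq> B"
  shows "(\<lambda>x\<in>B. A +>\<^bsub>M\<^esub> x) \<in>
      mod_hom R (M\<lparr>carrier := B\<rparr>) (quotient_module (M\<lparr>carrier := B\<rparr>) A)"
    and "\<And>x. x \<in> carrier M \<Longrightarrow> A +>\<^bsub>M\<^esub> x = A \<longleftrightarrow> x \<in> A"
proof -
  have sg: "subgroup A (add_monoid M)" using A by (simp add: submodule_def)
  interpret A: abelian_subgroup A M
    by (rule abelian_subgroupI3) (use sg in \<open>auto intro: additive_subgroup.intro M.abelian_group_axioms\<close>)
  note Bc = subsetD[OF submodule_subset[OF B]]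
  have cs: "A +>\<^bsub>M\<lparr>carrier := B\<rparr>\<^esub> x = A +>\<^bsub>M\<^esub> x" for x
    by (simp add: a_r_coset_def r_coset_def)
  show join: "A +>\<^bsub>M\<^esub> x = A \<longleftrightarrow> x \<in> A" if "x \<in> carrier M" for x
    using that M.a_coset_join1[OF _ that sg] M.a_coset_join2[OF that sg] by blast
  have sm: "(\<Union>y\<in>A +>\<^bsub>M\<^esub> x. A +>\<^bsub>M\<^esub> (a \<odot>\<^bsub>M\<^esub> y)) = A +>\<^bsub>M\<^esub> (a \<odot>\<^bsub>M\<^esub> x)"
    if a: "a \<in> carrier R" and x: "x \<in> carrier M" for a x
  proof -
    have "A +>\<^bsub>M\<^esub> (a \<odot>\<^bsub>M\<^esub> y) = A +>\<^bsub>M\<^esub> (a \<odot>\<^bsub>M\<^esub> x)" if y: "y \<in> A +>\<^bsub>M\<^esub> x" for y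
    proof -
      obtain n where n: "n \<in> A" "y = n \<oplus>\<^bsub>M\<^esub> x" using y by (auto simp: a_r_coset_def r_coset_def)
      hence nc: "n \<in> carrier M" using submodule_subset[OF A] by blast
      have "a \<odot>\<^bsub>M\<^esub> y = a \<odot>\<^bsub>M\<^esub> n \<oplus>\<^bsub>M\<^esub> a \<odot>\<^bsub>M\<^esub> x" using n nc a x by (simp add: smult_r_distr)
      moreover have "a \<odot>\<^bsub>M\<^esub> n \<in> A" using submodule_smult[OF A a n(1)] .
      ultimately have "a \<odot>\<^bsub>M\<^esub> y \<in> A +>\<^bsub>M\<^esub> (a \<odot>\<^bsub>M\<^esub> x)"
        by (auto simp: a_r_coset_def r_coset_def)
      from M.a_repr_independence[OF this smult_closed[OF a x] sg] show ?thesis by simp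
    qed
    moreover have "x \<in> A +>\<^bsub>M\<^esub> x" using A.a_rcos_self[OF x] .
    ultimately show ?thesis by blast
  qed
  have add: "set_add (M\<lparr>carrier := B\<rparr>) C D = C <+>\<^bsub>M\<^esub> D" for C D
    by (simp add: set_add_def set_mult_def)
  show "(\<lambda>x\<in>B. A +>\<^bsub>M\<^esub> x) \<in>
      mod_hom R (M\<lparr>carrier := B\<rparr>) (quotient_module (M\<lparr>carrier := B\<rparr>) A)"
  proof (rule mod_homI)
    fix x assume "x \<in> carrier (M\<lparr>carrier := B\<rparr>)"
    thus "(\<lambda>x\<in>B. A +>\<^bsub>M\<^esub> x) x \<in> carrier (quotient_module (M\<lparr>carrier := B\<rparr>) A)"
      by (auto simp: quotient_module_def A_RCOSETS_def RCOSETS_def a_r_coset_def r_coset_def)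
  next
    fix x y assume "x \<in> carrier (M\<lparr>carrier := B\<rparr>)" "y \<in> carrier (M\<lparr>carrier := B\<rparr>)"
    thus "(\<lambda>x\<in>B. A +>\<^bsub>M\<^esub> x) (x \<oplus>\<^bsub>M\<lparr>carrier := B\<rparr>\<^esub> y) =
      (\<lambda>x\<in>B. A +>\<^bsub>M\<^esub> x) x \<oplus>\<^bsub>quotient_module (M\<lparr>carrier := B\<rparr>) A\<^esub> (\<lambda>x\<in>B. A +>\<^bsub>M\<^esub> x) y"
      by (simp add: quotient_module_def submodule_add[OF B] A.a_rcos_sum Bc add)
  next
    fix a x assume "a \<in> carrier R" "x \<in> carrier (M\<lparr>carrier := B\<rparr>)"
    thus "(\<lambda>x\<in>B. A +>\<^bsub>M\<^esub> x) (a \<odot>\<^bsub>M\<lparr>carrier := B\<rparr>\<^esub> x) =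
      a \<odot>\<^bsub>quotient_module (M\<lparr>carrier := B\<rparr>) A\<^esub> (\<lambda>x\<in>B. A +>\<^bsub>M\<^esub> x) x"
      by (simp add: quotient_module_def submodule_smult[OF B] sm Bc cs)
  qed auto
qed

lemma (in left_module) left_module_submodule:
  assumes B: "submodule B R M"
  shows "left_module R (M\<lparr>carrier := B\<rparr>)"
proof -
  note Bc = subsetD[OF submodule_subset[OF B]]
  have "abelian_group (M\<lparr>carrier := B\<rparr>)"
  proof (rule abelian_groupI)
    fix x assume "x \<in> carrier (M\<lparr>carrier := B\<rparr>)"
    thus "\<exists>y\<in>carrier (M\<lparr>carrier := B\<rparr>). y \<oplus>\<^bsub>M\<lparr>carrier := B\<rparr>\<^esub> x = \<zero>\<^bsub>M\<lparr>carrier := B\<rparr>\<^esub>"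
      using submodule_minus[OF B] Bc by (auto intro!: bexI[of _ "\<ominus>\<^bsub>M\<^esub> x"] M.l_neg)
  qed (use submodule_add[OF B] submodule_zero[OF B] Bc in \<open>simp_all add: M.a_ac\<close>)
  thus ?thesis
    using submodule_smult[OF B] Bc R.ring_axioms
    by (simp add: left_module_def left_module_axioms_def smult_l_distr smult_r_distr
        smult_assoc smult_one)
qed

locale semibrick_filtration = left_module R M
  for R :: "('r, 'k) ring_scheme" and M :: "('r, 'm) module" +
  fixes \<X> :: "('r, 'x) module set" and r :: "'i rel" and F :: "'i \<Rightarrow> 'm set"
  assumes semibrick: "semibrick R \<X>" and X_filtration: "X_filtration R \<X> M r F"
begin

lemma filtration: "filtration R M r F"
  using X_filtration by (simp add: X_filtration_def)

lemma total: "a \<in> Field r \<Longrightarrow> b \<in> Field r \<Longrightarrow> a \<noteq> b \<Longrightarrow> (a, b) \<in> r \<or> (b, a) \<in> r"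
  using filtration by (simp add: filtration_def order_on_defs total_on_def)

lemma refl: "a \<in> Field r \<Longrightarrow> (a, a) \<in> r"
  using filtration by (simp add: filtration_def order_on_defs refl_on_def)

lemma trans: "trans r" and antisym: "antisym r" and wf: "wf (r - Id)"
  using filtration by (simp_all add: filtration_def order_on_defs)

lemma F_mono: "(a, b) \<in> r \<Longrightarrow> F a \<subseteq> F b"
  using filtration by (simp add: filtration_def)

lemma F_submodule: "a \<in> Field r \<Longrightarrow> submodule (F a) R M"
  using filtration by (simp add: filtration_def)

lemma left_module_X: "X \<in> \<X> \<Longrightarrow> left_module R X"
  using semibrick by (simp add: semibrick_def brick_def)

lemma abelian_group_X: "X \<in> \<X> \<Longrightarrow> abelian_group X"
  using left_module_X by (simp add: left_module_def)

lemma successor_less: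
  assumes "successor_in r a b"
  shows "a \<in> Field r" "b \<in> Field r" "(a, b) \<in> r" "a \<noteq> b"
proof -
  show ab: "a \<in> Field r" "b \<in> Field r" using assms by (simp_all add: successor_in_def)
  have "a \<in> under r a" using refl[OF ab(1)] by (simp add: under_def)
  hence "a \<in> underS r b" using assms by (simp add: successor_in_def)
  thus "(a, b) \<in> r" "a \<noteq> b" by (auto simp: underS_def)
qed

lemma successor_unique:
  assumes "successor_in r a b" "successor_in r a' b"
  shows "a = a'"
proof -
  have "under r a = under r a'" using assms by (simp add: successor_in_def)
  moreover have "a \<in> under r a" "a' \<in> under r a'"
    using refl successor_less assms by (auto simp: under_def)
  ultimately show ?thesis using antisym by (auto simp: under_def antisym_def)
qed

lemma successor_factor:
  assumes ab: "successor_in r a b"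
  obtains X p where "X \<in> \<X>" "p \<in> mod_hom R (M\<lparr>carrier := F b\<rparr>) X"
    "\<And>x. x \<in> F b \<Longrightarrow> p x = \<zero>\<^bsub>X\<^esub> \<longleftrightarrow> x \<in> F a"
proof -
  let ?B = "M\<lparr>carrier := F b\<rparr>"
  obtain X q where X: "X \<in> \<X>" and q: "q \<in> mod_hom R (quotient_module ?B (F a)) X"
    and bij: "bij_betw q (carrier (quotient_module ?B (F a))) (carrier X)"
    using X_filtration ab unfolding X_filtration_def mod_iso_def by blast
  note Fa = F_submodule[OF successor_less(1)[OF ab]]
  note Fb = F_submodule[OF successor_less(2)[OF ab]]
  note k = quotient_map(1)[OF Fa Fb F_mono[OF successor_less(3)[OF ab]]]
  note join = quotient_map(2)[OF Fa Fb F_mono[OF successor_less(3)[OF ab]]]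
  define p where "p = compose (F b) q (\<lambda>x\<in>F b. F a +>\<^bsub>M\<^esub> x)"
  have B: "left_module R ?B" by (rule left_module_submodule[OF Fb])
  have p: "p \<in> mod_hom R ?B X"
    using mod_hom_compose[OF B k q] by (simp add: p_def)
  have z: "\<zero>\<^bsub>M\<^esub> \<in> F b" by (rule submodule_zero[OF Fb])
  have p0: "p \<zero>\<^bsub>M\<^esub> = \<zero>\<^bsub>X\<^esub>"
    using mod_hom_zero[OF _ abelian_group_X[OF X] p] B by (simp add: left_module_def)
  have "p x = \<zero>\<^bsub>X\<^esub> \<longleftrightarrow> x \<in> F a" if x: "x \<in> F b" for x
  proof -
    have xc: "x \<in> carrier M" using submodule_subset[OF Fb] x by blast
    have kc: "F a +>\<^bsub>M\<^esub> y \<in> carrier (quotient_module ?B (F a))" if "y \<in> F b" for y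
      using mod_hom_closed[OF k, of y] that by simp
    have "p x = \<zero>\<^bsub>X\<^esub> \<longleftrightarrow> p x = p \<zero>\<^bsub>M\<^esub>" by (simp add: p0)
    also have "\<dots> \<longleftrightarrow> q (F a +>\<^bsub>M\<^esub> x) = q (F a +>\<^bsub>M\<^esub> \<zero>\<^bsub>M\<^esub>)" using x z by (simp add: p_def compose_eq)
    also have "\<dots> \<longleftrightarrow> F a +>\<^bsub>M\<^esub> x = F a +>\<^bsub>M\<^esub> \<zero>\<^bsub>M\<^esub>"
      using bij_betw_imp_inj_on[OF bij] kc[OF x] kc[OF z] by (rule inj_on_eq_iff)
    also have "F a +>\<^bsub>M\<^esub> \<zero>\<^bsub>M\<^esub> = F a" using join submodule_zero[OF Fa] by simp
    finally show ?thesis using join[OF xc] by simp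
  qed
  thus ?thesis using that X p by blast
qed

definition splits_step :: "'i \<Rightarrow> 'i \<Rightarrow> ('r, 'x) module \<Rightarrow> ('x \<Rightarrow> 'm) \<Rightarrow> bool" where
  "splits_step a b X f \<longleftrightarrow> successor_in r a b \<and> X \<in> \<X> \<and> f \<in> mod_hom R X M \<and>
     f ` carrier X \<subseteq> F b \<and> \<not> f ` carrier X \<subseteq> F a"

lemma splits_stepD:
  assumes "splits_step a b X f"
  shows "successor_in r a b" "X \<in> \<X>" "f \<in> mod_hom R X M" "\<And>x. x \<in> carrier X \<Longrightarrow> f x \<in> F b"
  using assms by (auto simp: splits_step_def)

lemma splits_step_iso:
  assumes f: "splits_step a b X f" and Y: "Y \<in> \<X>" and p: "p \<in> mod_hom R (M\<lparr>carrier := F b\<rparr>) Y"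
    and ker: "\<And>x. x \<in> F b \<Longrightarrow> p x = \<zero>\<^bsub>Y\<^esub> \<longleftrightarrow> x \<in> F a"
  shows "X = Y" and "compose (carrier X) p f \<in> mod_hom R X Y"
    and "\<exists>h\<in>mod_hom R X X. \<forall>x\<in>carrier X. h (p (f x)) = x \<and> p (f (h x)) = x"
proof -
  note D = splits_stepD[OF f]
  have f': "f \<in> mod_hom R X (M\<lparr>carrier := F b\<rparr>)"
    using D(3,4) by (auto simp: mod_hom_def PiE_iff)
  show pf: "compose (carrier X) p f \<in> mod_hom R X Y"
    by (rule mod_hom_compose[OF left_module_X[OF D(2)] f' p])
  obtain x where x: "x \<in> carrier X" "f x \<notin> F a" using f by (auto simp: splits_step_def)
  hence "compose (carrier X) p f x \<noteq> \<zero>\<^bsub>Y\<^esub>" using ker D(4) by (simp add: compose_eq)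
  then obtain h where h: "X = Y" "h \<in> mod_hom R X X"
    "\<And>x. x \<in> carrier X \<Longrightarrow> h (compose (carrier X) p f x) = x"
    "\<And>x. x \<in> carrier X \<Longrightarrow> compose (carrier X) p f (h x) = x"
    by (rule semibrick_hom[OF semibrick D(2) Y pf x(1)]) (rule that)
  show "X = Y" by (rule h(1))
  show "\<exists>h\<in>mod_hom R X X. \<forall>x\<in>carrier X. h (p (f x)) = x \<and> p (f (h x)) = x"
    using h(3,4) mod_hom_closed[OF h(2)] by (intro bexI[OF _ h(2)]) (simp add: compose_eq)
qed

lemma splits_step_inj:
  assumes f: "splits_step a b X f" and x: "x \<in> carrier X" and fx: "f x \<in> F a"
  shows "x = \<zero>\<^bsub>X\<^esub>"
proof -
  note D = splits_stepD[OF f]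
  obtain Y p where Y: "Y \<in> \<X>" and p: "p \<in> mod_hom R (M\<lparr>carrier := F b\<rparr>) Y"
    and ker: "\<And>x. x \<in> F b \<Longrightarrow> p x = \<zero>\<^bsub>Y\<^esub> \<longleftrightarrow> x \<in> F a"
    by (rule successor_factor[OF D(1)]) (rule that)
  note iso = splits_step_iso[OF f Y p ker]
  obtain h where h: "h \<in> mod_hom R X X" "\<And>x. x \<in> carrier X \<Longrightarrow> h (p (f x)) = x"
    using iso(3) by auto
  have "x = h \<zero>\<^bsub>X\<^esub>" using iso(1) h(2)[OF x] ker[OF D(4)[OF x]] fx by simp
  thus ?thesis
    using mod_hom_zero[OF abelian_group_X[OF D(2)] abelian_group_X[OF D(2)] h(1)] by simp
qed

text \<open>Both homomorphisms induce isomorphisms onto the factor \<open>F b / F a\<close>.\<close>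

lemma splits_step_lift:
  assumes f: "splits_step a b X f" and g: "splits_step a b Y g"
  obtains h where "h \<in> mod_hom R X Y" "\<And>x. x \<in> carrier X \<Longrightarrow> f x \<ominus>\<^bsub>M\<^esub> g (h x) \<in> F a"
proof -
  note Df = splits_stepD[OF f] and Dg = splits_stepD[OF g]
  note Fb = F_submodule[OF successor_less(2)[OF Df(1)]]
  obtain Z p where Z: "Z \<in> \<X>" and p: "p \<in> mod_hom R (M\<lparr>carrier := F b\<rparr>) Z"
    and ker: "\<And>x. x \<in> F b \<Longrightarrow> p x = \<zero>\<^bsub>Z\<^esub> \<longleftrightarrow> x \<in> F a"
    by (rule successor_factor[OF Df(1)]) (rule that)
  note pf = splits_step_iso(2)[OF f Z p ker]
  note YZ = splits_step_iso(1)[OF g Z p ker]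
  obtain k where k: "k \<in> mod_hom R Y Y" "\<And>y. y \<in> carrier Y \<Longrightarrow> p (g (k y)) = y"
    using splits_step_iso(3)[OF g Z p ker] by auto
  interpret Z: abelian_group Z by (rule abelian_group_X[OF Z])
  define h where "h = compose (carrier X) k (compose (carrier X) p f)"
  have h: "h \<in> mod_hom R X Y"
    unfolding h_def using mod_hom_compose[OF left_module_X[OF Df(2)] pf] k(1) YZ by simp
  moreover have "f x \<ominus>\<^bsub>M\<^esub> g (h x) \<in> F a" if x: "x \<in> carrier X" for x
  proof -
    let ?d = "f x \<ominus>\<^bsub>M\<^esub> g (h x)"
    have fb: "f x \<in> F b" and gb: "g (h x) \<in> F b"
      using Df(4)[OF x] Dg(4)[OF mod_hom_closed[OF h x]] .
    hence c: "f x \<in> carrier M" "g (h x) \<in> carrier M" using submodule_subset[OF Fb] by blast+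
    have d: "?d \<in> F b"
      unfolding a_minus_def by (intro submodule_add[OF Fb] submodule_minus[OF Fb] fb gb)
    have pfx: "p (f x) \<in> carrier Z" using mod_hom_closed[OF pf x] x by (simp add: compose_eq)
    have pg: "p (g (h x)) = p (f x)" using k(2)[of "p (f x)"] pfx YZ x by (simp add: h_def compose_eq)
    have "?d \<oplus>\<^bsub>M\<^esub> g (h x) = f x" using c by (simp add: a_minus_def M.a_assoc M.l_neg)
    hence "p (f x) = p ?d \<oplus>\<^bsub>Z\<^esub> p (g (h x))" using mod_hom_add[OF p, of ?d "g (h x)"] d gb by simp
    hence "p (f x) = p ?d \<oplus>\<^bsub>Z\<^esub> p (f x)" by (simp add: pg)
    moreover have "p ?d \<in> carrier Z" using mod_hom_closed[OF p, of ?d] d by simp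
    ultimately have "p ?d = \<zero>\<^bsub>Z\<^esub>" using pfx Z.add.r_cancel_one' by metis
    thus ?thesis using ker[OF d] by simp
  qed
  ultimately show ?thesis by (rule that)
qed

lemma limit_factor:
  assumes b: "limit_in r b" and X: "X \<in> \<X>" and g: "g \<in> mod_hom R X M" and gb: "g ` carrier X \<subseteq> F b"
  obtains a where "a \<in> underS r b" "g ` carrier X \<subseteq> F a"
proof -
  obtain G where G: "finite G" "G \<subseteq> carrier X"
    "\<And>H. submodule H R X \<Longrightarrow> G \<subseteq> H \<Longrightarrow> H = carrier X"
    using finitely_presented_generators[OF R.ring_axioms left_module_X[OF X]] semibrick X
    by (auto simp: semibrick_def brick_def)
  have Fb: "F b = (\<Union>a\<in>underS r b. F a)" using filtration b by (simp add: filtration_def)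
  have uF: "a \<in> Field r" if "a \<in> underS r b" for a using that by (auto simp: underS_def Field_def)
  have "\<exists>a\<in>underS r b. g ` G \<subseteq> F a" using G(1,2)
  proof (induction G)
    case empty
    thus ?case using b by (auto simp: limit_in_def)
  next
    case (insert y G)
    then obtain a where a: "a \<in> underS r b" "g ` G \<subseteq> F a" by auto
    have "g y \<in> F b" using insert.prems gb by blast
    then obtain c where c: "c \<in> underS r b" "g y \<in> F c" using Fb by auto
    have "F a \<subseteq> F c \<or> F c \<subseteq> F a"
      using total[OF uF[OF a(1)] uF[OF c(1)]] F_mono by (cases "a = c") auto
    thus ?case using a c by auto
  qed
  then obtain a where a: "a \<in> underS r b" "g ` G \<subseteq> F a" by blast
  have "{x \<in> carrier X. g x \<in> F a} = carrier X"
    by (rule G(3)[OF submodule_vimage[OF left_module_X[OF X] g F_submodule[OF uF[OF a(1)]]]])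
      (use a G(2) in auto)
  thus ?thesis using that a(1) by blast
qed

lemma finite_has_top:
  assumes "finite J" "J \<noteq> {}" "J \<subseteq> Field r"
  shows "\<exists>b\<in>J. \<forall>i\<in>J. (i, b) \<in> r"
  using assms
proof (induction J rule: finite_ne_induct)
  case (singleton x)
  thus ?case using refl by simp
next
  case (insert x J)
  then obtain b where b: "b \<in> J" "\<forall>i\<in>J. (i, b) \<in> r" by auto
  have bF: "b \<in> Field r" "x \<in> Field r" using insert.prems b(1) by auto
  show ?case
  proof (cases "(x, b) \<in> r")
    case True
    thus ?thesis using b by auto
  next
    case False
    hence "(b, x) \<in> r" using total[OF bF] refl[OF bF(2)] by auto
    hence "\<forall>i\<in>insert x J. (i, x) \<in> r" using b refl[OF bF(2)] trans by (auto dest: transD)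
    thus ?thesis by blast
  qed
qed

lemma semisimple_if_trace:
  assumes tr: "trace R \<X> M = carrier M"
  shows "X_semisimple R \<X> M"
proof -
  define I where "I = {b. \<exists>a X f. splits_step a b X f}"
  have "\<forall>b\<in>I. \<exists>a X f. splits_step a b X f" by (simp add: I_def)
  then obtain A S e where step: "\<And>b. b \<in> I \<Longrightarrow> splits_step (A b) b (S b) (e b)" by metis
  note step' = splits_stepD[OF step]
  let ?D = "direct_sum I S" and ?s = "direct_sum_map I S e"
  have S: "left_module R (S i)" if "i \<in> I" for i using left_module_X[OF step'(2)[OF that]] .
  have D: "left_module R ?D" by (rule left_module_direct_sum[OF R.ring_axioms S])
  have s: "?s \<in> mod_hom R ?D M" by (rule direct_sum_map_hom[OF S step'(3)])
  define T where "T = ?s ` carrier ?D"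
  have T: "submodule T R M" unfolding T_def by (rule submodule_image[OF D s])
  have eT: "e i x \<in> T" if "i \<in> I" "x \<in> carrier (S i)" for i x
    using imageI[OF single_closed[of I R S, OF S that], of ?s]
      direct_sum_map_single[of I S e, OF S step'(3) that] by (simp add: T_def)
  have span: "g ` carrier X \<subseteq> T"
    if "b \<in> Field r" "X \<in> \<X>" "g \<in> mod_hom R X M" "g ` carrier X \<subseteq> F b" for b X g
    using wf that
  proof (induction b arbitrary: g rule: wf_induct_rule)
    case (less b)
    have IH: "g' ` carrier X \<subseteq> T"
      if "a \<in> underS r b" "g' \<in> mod_hom R X M" "g' ` carrier X \<subseteq> F a" for a g'
      using that less.IH[of a g'] less.prems(2) by (auto simp: underS_def Field_def)
    consider "underS r b = {}" | "limit_in r b" | a where "successor_in r a b"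
      using less.prems(1) by (auto simp: limit_in_def)
    thus ?case
    proof cases
      case 1
      hence "F b = {\<zero>\<^bsub>M\<^esub>}" using filtration less.prems(1) by (simp add: filtration_def)
      thus ?thesis using less.prems(4) submodule_zero[OF T] by auto
    next
      case 2
      obtain a where "a \<in> underS r b" "g ` carrier X \<subseteq> F a"
        by (rule limit_factor[OF 2 less.prems(2-4)])
      thus ?thesis using IH less.prems(3) by simp
    next
      case 3
      have a: "a \<in> underS r b" using successor_less[OF 3] by (simp add: underS_def)
      show ?thesis
      proof (cases "g ` carrier X \<subseteq> F a")
        case True
        thus ?thesis using IH[OF a less.prems(3)] by simp
      next
        case False
        hence g: "splits_step a b X g" using 3 less.prems by (simp add: splits_step_def)
        hence b: "b \<in> I" by (auto simp: I_def)
        have "A b = a" using successor_unique[OF step'(1)[OF b] 3] .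
        hence eb: "splits_step a b (S b) (e b)" using step[OF b] by simp
        obtain h where h: "h \<in> mod_hom R X (S b)"
          and d: "\<And>x. x \<in> carrier X \<Longrightarrow> g x \<ominus>\<^bsub>M\<^esub> e b (h x) \<in> F a"
          by (rule splits_step_lift[OF g eb]) (rule that)
        note X = left_module_X[OF less.prems(2)]
        define k where "k = (\<lambda>x\<in>carrier X. g x \<ominus>\<^bsub>M\<^esub> compose (carrier X) (e b) h x)"
        have k: "k \<in> mod_hom R X M" unfolding k_def
          by (rule mod_hom_diff[OF X less.prems(3) mod_hom_compose[OF X h step'(3)[OF b]]])
        have kT: "k ` carrier X \<subseteq> T"
          by (rule IH[OF a k]) (use d in \<open>auto simp: k_def compose_eq\<close>)
        show ?thesis
        proof (rule image_subsetI)
          fix x assume x: "x \<in> carrier X"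
          have eh: "e b (h x) \<in> T" by (rule eT[OF b mod_hom_closed[OF h x]])
          hence c: "e b (h x) \<in> carrier M" using submodule_subset[OF T] by blast
          have "g x = k x \<oplus>\<^bsub>M\<^esub> e b (h x)"
            using x c mod_hom_closed[OF less.prems(3) x]
            by (simp add: k_def compose_eq a_minus_def M.a_assoc M.l_neg)
          moreover have "k x \<in> T" using kT x by blast
          ultimately show "g x \<in> T" using submodule_add[OF T _ eh] by simp
        qed
      qed
    qed
  qed
  obtain t where t: "t \<in> Field r" "F t = carrier M" using filtration by (auto simp: filtration_def)
  have Y: "y \<in> T" if "X \<in> \<X>" "g \<in> mod_hom R X M" "y \<in> g ` carrier X" for X g y
    using span[OF t(1) that(1,2)] that(3) mod_hom_closed[OF that(2)] t(2) by blast
  have "finsum M x J \<in> T"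
    if "finite J" "J \<subseteq> (SIGMA X:\<X>. mod_hom R X M)" "x \<in> (\<Pi> (X, f)\<in>J. f ` carrier X)" for x J
  proof (rule submodule_finsum[OF T that(1)])
    fix j assume j: "j \<in> J"
    obtain X g where Xg: "j = (X, g)" by (cases j)
    have "X \<in> \<X>" "g \<in> mod_hom R X M" using j that(2) Xg by auto
    moreover have "x j \<in> g ` carrier X" using PiE[OF that(3), of j] j Xg by auto
    ultimately show "x j \<in> T" by (rule Y)
  qed
  hence "trace R \<X> M \<subseteq> T" by (auto simp: trace_def submodule_sum_def)
  hence onto: "?s ` carrier ?D = carrier M"
    using tr submodule_subset[OF T] by (simp add: T_def subset_antisym)
  have ker: "x = \<zero>\<^bsub>?D\<^esub>" if x: "x \<in> carrier ?D" and sx: "?s x = \<zero>\<^bsub>M\<^esub>" for x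
  proof (cases "{i \<in> I. x i \<noteq> \<zero>\<^bsub>S i\<^esub>} = {}")
    case True
    thus ?thesis using x by (auto simp: direct_sum_def fun_eq_iff PiE_def extensional_def)
  next
    case False
    define J where "J = {i \<in> I. x i \<noteq> \<zero>\<^bsub>S i\<^esub>}"
    have J: "finite J" "J \<subseteq> I" using x by (auto simp: J_def direct_sum_def)
    have IF: "i \<in> Field r" if "i \<in> I" for i using successor_less(2)[OF step'(1)[OF that]] .
    obtain b where b: "b \<in> J" and top: "\<And>i. i \<in> J \<Longrightarrow> (i, b) \<in> r"
      using finite_has_top[OF J(1)] False IF J(2) by (auto simp: J_def)
    have bI: "b \<in> I" using b J by blast
    have xc: "x i \<in> carrier (S i)" if "i \<in> I" for i using x that by (auto simp: direct_sum_def)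
    have eF: "e i (x i) \<in> F i" if "i \<in> I" for i using step'(4)[OF that xc[OF that]] .
    have ec: "e i (x i) \<in> carrier M" if "i \<in> I" for i
      using mod_hom_closed[OF step'(3)[OF that] xc[OF that]] .
    have FA: "submodule (F (A b)) R M" using F_submodule successor_less(1)[OF step'(1)[OF bI]] .
    let ?r = "finsum M (\<lambda>i. e i (x i)) (J - {b})"
    have "?r \<in> F (A b)"
    proof (rule submodule_finsum[OF FA])
      fix i assume i: "i \<in> J - {b}"
      hence "i \<in> underS r b" using top by (auto simp: underS_def)
      hence "(i, A b) \<in> r" using step'(1)[OF bI] by (simp add: successor_in_def under_def)
      thus "e i (x i) \<in> F (A b)" using F_mono eF i J(2) by blast
    qed (use J in simp)
    moreover have "?r \<in> carrier M" using calculation submodule_subset[OF FA] by blast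
    moreover have "e b (x b) \<oplus>\<^bsub>M\<^esub> ?r = \<zero>\<^bsub>M\<^esub>"
    proof -
      have "?s x = finsum M (\<lambda>i. e i (x i)) J"
        by (rule direct_sum_map_eq[OF S step'(3) x J]) (auto simp: J_def)
      also have "J = insert b (J - {b})" using b by auto
      also have "finsum M (\<lambda>i. e i (x i)) (insert b (J - {b})) = e b (x b) \<oplus>\<^bsub>M\<^esub> ?r"
        by (rule M.finsum_insert) (use J ec bI in auto)
      finally show ?thesis using sx by simp
    qed
    ultimately have "e b (x b) \<in> F (A b)"
      using submodule_minus[OF FA] M.minus_equality[of "e b (x b)" ?r] ec[OF bI] by metis
    hence "x b = \<zero>\<^bsub>S b\<^esub>" by (rule splits_step_inj[OF step[OF bI] xc[OF bI]])
    thus ?thesis using b by (simp add: J_def)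
  qed
  have "mod_iso R M ?D" by (rule mod_iso_direct_sumI[OF left_module_axioms S s onto ker])
  thus ?thesis
    using step'(2) by (intro X_semisimpleI[OF semibrick left_module_axioms]) auto
qed

end

lemma (in left_module) trace_submodule:
  assumes "\<And>X. X \<in> \<X> \<Longrightarrow> left_module R X"
  shows "submodule (trace R \<X> M) R M"
  unfolding trace_def using assms submodule_image
  by (intro submodule_submodule_sum) auto

lemma trace_if_semisimple:
  fixes M :: "('r, 'm) module"
  assumes M: "left_module R M" and X: "\<And>X. X \<in> \<X> \<Longrightarrow> left_module R X"
    and "X_semisimple R \<X> M"
  shows "trace R \<X> M = carrier M"
proof -
  interpret left_module R M by fact
  obtain I :: "'m set" and S where SX: "S \<in> I \<rightarrow> \<X>" and iso: "mod_iso R M (direct_sum I S)"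
    using assms(3) by (auto simp: X_semisimple_def)
  let ?D = "direct_sum I S"
  have S: "left_module R (S i)" if "i \<in> I" for i using X SX that by blast
  have D: "left_module R ?D" by (rule left_module_direct_sum[OF R.ring_axioms S])
  obtain f where f: "f \<in> mod_hom R ?D M" and onto: "f ` carrier ?D = carrier M"
    using mod_iso_sym[OF M iso] by (auto simp: mod_iso_def bij_betw_def)
  have T: "submodule (trace R \<X> M) R M" by (rule trace_submodule[OF X])
  have "f x \<in> trace R \<X> M" if "x \<in> carrier ?D" for x
    using that
  proof (induction x rule: direct_sum_induct[where R = R])
    case (left_module i)
    thus ?case by (rule S)
  next
    case zero
    have "f \<zero>\<^bsub>?D\<^esub> = \<zero>\<^bsub>M\<^esub>"
      using D M by (intro mod_hom_zero[OF _ _ f]) (simp_all add: left_module_def)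
    thus ?case using submodule_zero[OF T] by simp
  next
    case (add x y)
    thus ?case using submodule_add[OF T] by (simp add: mod_hom_add[OF f])
  next
    case (single i s)
    define g where "g = compose (carrier (S i)) f (restrict (single I S i) (carrier (S i)))"
    have g: "g \<in> mod_hom R (S i) M"
      unfolding g_def
      by (rule mod_hom_compose[OF S[OF single(1)] single_hom[of I R S, OF S single(1)] f])
    have gs: "f (single I S i s) = g s" using single(2) by (simp add: g_def compose_eq)
    show ?case unfolding gs trace_def
      by (rule submodule_sum_member[of "(S i, g)"])
        (use g single SX mod_hom_closed[OF g single(2)] in auto)
  qed
  hence "carrier M \<subseteq> trace R \<X> M" unfolding onto[symmetric] by (rule image_subsetI)
  thus ?thesis using submodule_subset[OF T] by (rule subset_antisym[rotated])
qed

theorem proposition3p2: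
  fixes R :: "('r, 'k) ring_scheme"
    and \<X> :: "('r, 'x) module set"
    and M :: "('r, 'm) module"
  assumes "ring R"
    and "semibrick R \<X>"
    and "M \<in> Filt R \<X>"
  shows "X_semisimple R \<X> M \<longleftrightarrow> trace R \<X> M = carrier M"
proof
  have M: "left_module R M" using assms(3) by (simp add: Filt_def)
  {
    assume "X_semisimple R \<X> M"
    thus "trace R \<X> M = carrier M"
      using assms(2) by (intro trace_if_semisimple[OF M]) (auto simp: semibrick_def brick_def)
  next
    assume tr: "trace R \<X> M = carrier M"
    obtain r :: "'m rel" and F where "X_filtration R \<X> M r F"
      using assms(3) by (auto simp: Filt_def)
    then interpret semibrick_filtration R M \<X> r F
      using M assms(2) by (simp add: semibrick_filtration_def semibrick_filtration_axioms_def)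
    show "X_semisimple R \<X> M" by (rule semisimple_if_trace[OF tr])
  }
qed

end
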